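(* Let $\delta$ be an ordinal and let $\langle\Phi_\alpha:\alpha\le\delta\rangle$ be a Scott process with nonempty levels such that $\Phi_\delta$ amalgamates and $|\Phi_\delta|\le\aleph_1$. Then $\langle\Phi_\alpha:\alpha\le\delta\rangle$ has a model; that is, there is a $\tau$-structure $M$ with $\Phi_\alpha(M)=\Phi_\alpha$ for all $\alpha\le\delta$.
   Context: Conventions. $\tau$ is a fixed relational vocabulary containing a $0$-ary relation symbol and $=$ (interpreted as equality); $x_0,x_1,\dots$ are distinct variables; conjunctions and disjunctions in $\mathcal{L}_{\infty,\omega}(\tau)$ are over unordered sets. $X_n=\{x_m:m<n\}$, $i_n$ is the identity function on $X_n$, and $\mathcal I_{m,n}$ ($m\le n$) is the set of injections from $X_m$ to $X_n$ ($i_m$ is also regarded as the inclusion, a member of $\mathcal I_{m,n}$). Formulas. By recursion on $\alpha$ define $\Psi^n_\alpha$ ($n\in\omega$) and $\Psi_\alpha=\bigcup_n\Psi^n_\alpha$. $\Psi^n_0$ is the set of all conjunctions consisting of, for each atomic $\tau$-formula with variables from $X_n$, either the formula or its negation, including $x_i\ne x_j$ for all distinct $x_i,x_j\in X_n$. $\Psi^n_{\alpha+1}$ is the set of all $\phi$ of the form $\phi'\wedge\bigwedge_{\psi\in E}\exists x_n\psi\wedge\forall x_n(x_n\notin\{x_0,\dots,x_{n-1}\}\to\bigvee_{\psi\in E}\psi)$ with $\phi'\in\Psi^n_\alpha$ and $E\subseteq\Psi^{n+1}_\alpha$; write $V_{\alpha,\alpha+1}(\phi)=\phi'$ and $E(\phi)=E$.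 For limit $\alpha$, $\Psi^n_\alpha$ is the set of conjunctions $\bigwedge_{\beta<\alpha}\psi_\beta$ with $\psi_\beta\in\Psi^n_\beta$, $V_{\beta,\beta+1}(\psi_{\beta+1})=\psi_\beta$ for all $\beta<\alpha$, and $\psi_\beta=\bigwedge_{\gamma<\beta}\psi_\gamma$ for limit $\beta<\alpha$. Vertical projections $V_{\alpha,\beta}:\Psi_\beta\to\Psi_\alpha$ ($\alpha\le\beta$): $V_{\alpha,\alpha}$ is the identity; $V_{\alpha,\alpha+1}$ sends each $\phi\in\Psi^n_{\alpha+1}$ to its first conjunct $\phi'\in\Psi^n_\alpha$; for limit $\beta>\alpha$, $V_{\alpha,\beta}(\phi)$ is the unique conjunct of $\phi$ in $\Psi_\alpha$; $V_{\alpha,\beta+1}=V_{\alpha,\beta}\circ V_{\beta,\beta+1}$ for $\alpha<\beta$. Horizontal projections: for $\phi\in\Psi^n_\alpha$, $m\le n$, $j\in\mathcal I_{m,n}$, define $H^n_\alpha(\phi,j)\in\Psi^m_\alpha$: $H^n_0(\phi,j)$ is the conjunction of the conjuncts of $\phi$ whose variables lie in $\mathrm{range}(j)$, with variables replaced by their $j$-preimages; $H^n_{\alpha+1}(\phi,j)$ is the $\psi\in\Psi^m_{\alpha+1}$ with $V_{\alpha,\alpha+1}(\psi)=H^n_\alpha(V_{\alpha,\alpha+1}(\phi),j)$ and $E(\psi)=\{H^{n+1}_\alpha(\theta,j\cup\{(x_m,y)\}):\theta\in E(\phi),\,y\in X_{n+1}\setminus\mathrm{range}(j)\}$; for limit $\alpha$,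 $H^n_\alpha(\phi,j)=\bigwedge_{\beta<\alpha}H^n_\beta(V_{\beta,\alpha}(\phi),j)$. Scott processes. A Scott process of length $\delta$ is a sequence $\langle\Phi_\alpha:\alpha<\delta\rangle$ such that, writing $\Phi^n_\alpha=\Phi_\alpha\cap\Psi^n_\alpha$: (1a) $\Phi_\alpha\subseteq\Psi_\alpha$; (1b) $E(\phi)\subseteq\Phi_\alpha$ whenever $\alpha+1<\delta$, $\phi\in\Phi_{\alpha+1}$; (1c) $\Phi_\alpha=V_{\alpha,\beta}[\Phi_\beta]$ for $\alpha<\beta<\delta$; (1d) $H^n_\alpha(\phi,j)\in\Phi^n_\alpha$ for $\phi\in\Phi^n_\alpha$, $j\in\mathcal I_{n,n}$; (1e) $\Phi^m_\alpha=H^n_\alpha[\Phi^n_\alpha\times\{i_m\}]$ for $m<n$; (2a) for $\alpha+1<\delta$, $\phi\in\Phi^n_{\alpha+1}$: $E(\phi)=V_{\alpha,\alpha+1}[\{\psi\in\Phi^{n+1}_{\alpha+1}:H^{n+1}_{\alpha+1}(\psi,i_n)=\phi\}]$; (2b) for $\alpha<\beta<\delta$, $\phi\in\Phi^n_\beta$: $E(V_{\alpha+1,\beta}(\phi))\subseteq V_{\alpha,\beta}[\{\psi\in\Phi^{n+1}_\beta:H^{n+1}_\beta(\psi,i_n)=\phi\}]$; (2c) for $\phi\in\Phi^n_\alpha$, $\psi\in\Phi^m_\alpha$ there are $\theta\in\Phi^{n+m}_\alpha$ and $j\in\mathcal I_{m,n+m}$ with $\phi=H^{n+m}_\alpha(\theta,i_n)$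 and $\psi=H^{n+m}_\alpha(\theta,j)$. The sets $\Phi_\alpha$ are the levels of the process. Amalgamation. A set $\Phi\subseteq\Psi_\delta$ amalgamates if for all $m<n$ in $\omega$, $\phi\in\Phi\cap\Psi^{m+1}_\delta$ and $\psi\in\Phi\cap\Psi^n_\delta$ with $H^{m+1}_\delta(\phi,i_m)=H^n_\delta(\psi,i_m)$, there exist $\theta\in\Phi\cap\Psi^{n+1}_\delta$ and $y\in X_{n+1}\setminus X_m$ such that $H^{n+1}_\delta(\theta,i_m\cup\{(x_m,y)\})=\phi$ and $H^{n+1}_\delta(\theta,i_n)=\psi$. Scott process of a structure. For a $\tau$-structure $M$ and a tuple $\bar a$ of $n$ distinct elements of $M$: $\phi^M_{\bar a,0}$ is the conjunction of all atomic and negated atomic formulas in variables $X_n$ satisfied by $\bar a$ in $M$; $\phi^M_{\bar a,\alpha+1}$ is the $\phi\in\Psi^n_{\alpha+1}$ with $V_{\alpha,\alpha+1}(\phi)=\phi^M_{\bar a,\alpha}$ and $E(\phi)=\{\phi^M_{\bar a^\frown\langle c\rangle,\alpha}:c\in M\text{ not in }\bar a\}$; $\phi^M_{\bar a,\beta}=\bigwedge_{\alpha<\beta}\phi^M_{\bar a,\alpha}$ for limit $\beta$. $\Phi_\alpha(M)$ is the set of all $\phi^M_{\bar a,\alpha}$, $\bar a$ a finite tuple of distinct elements of $M$.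
   Formalization: The conjunctions in Ψ^n_0 are required to contain x_i = x_i (not its negation) for each x_i in X_n; read literally, the definition would allow the conjunct x_i ≠ x_i, and a Scott process built from such formulas has no model. *)

theory Defs
  imports Main
begin

unbundle cardinal_syntax

section \<open>Ordinals\<close>

text \<open>Ordinals are the elements of an arbitrary type of class wellorder; such an element stands for
  the order type of the set of its predecessors.\<close>

definition zero_ord :: "'o::wellorder \<Rightarrow> bool" where
  "zero_ord \<alpha> \<longleftrightarrow> (\<forall>\<beta>. \<alpha> \<le> \<beta>)"

definition succ_of :: "'o::wellorder \<Rightarrow> 'o \<Rightarrow> bool" where
  "succ_of \<alpha> \<beta> \<longleftrightarrow> \<alpha> < \<beta> \<and> (\<forall>\<gamma>. \<alpha> < \<gamma> \<longrightarrow> \<beta> \<le> \<gamma>)"  \<comment> \<open>\<open>\<beta> = \<alpha> + 1\<close>\<close>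

definition limit_ord :: "'o::wellorder \<Rightarrow> bool" where
  "limit_ord \<beta> \<longleftrightarrow> \<not> zero_ord \<beta> \<and> (\<nexists>\<alpha>. succ_of \<alpha> \<beta>)"

definition pred_ord :: "'o::wellorder \<Rightarrow> 'o" where
  "pred_ord \<beta> = (THE \<alpha>. succ_of \<alpha> \<beta>)"

lemma pred_ord_eq: "succ_of \<alpha> \<beta> \<Longrightarrow> pred_ord \<beta> = \<alpha>"
  unfolding pred_ord_def
  by (rule the_equality) (auto simp: succ_of_def not_less[symmetric] intro: linorder_cases)

lemma pred_ord_less:
  assumes "\<not> zero_ord \<beta>" "\<not> limit_ord \<beta>"
  shows "pred_ord \<beta> < \<beta>"
proof -
  obtain \<alpha> where "succ_of \<alpha> \<beta>" using assms by (auto simp: limit_ord_def)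
  then show ?thesis by (simp add: pred_ord_eq) (simp add: succ_of_def)
qed

section \<open>Infinitary formulas\<close>

text \<open>The vocabulary is a type \<open>'r\<close> of relation symbols with an arity function; equality is
  the separate constructor \<open>Eq\<close>. The variable \<open>x\<^sub>i\<close> is represented by \<open>i\<close>.
  A datatype cannot recurse through unrestricted sets, so the infinitary connectives take families
  indexed by (part of) a type \<open>'i\<close>.  The formulas with conjunctions and disjunctions over
  unordered sets are those built with \<open>BigAnd\<close> and \<open>BigOr\<close> below, which fix one enumeration
  for each set. Hence \<open>BigAnd A = BigAnd B\<close> iff \<open>A = B\<close>, as long as
  \<open>A\<close> and \<open>B\<close> have at most \<open>|'i|\<close> elements.\<close>

datatype ('r, 'i) fm =
    Rel 'r "nat list"
  | Eq nat nat
  | Neg "('r, 'i) fm"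
  | And "('r, 'i) fm" "('r, 'i) fm"
  | Imp "('r, 'i) fm" "('r, 'i) fm"
  | Ex nat "('r, 'i) fm"
  | All nat "('r, 'i) fm"
  | Conj "'i \<Rightarrow> ('r, 'i) fm option"
  | Disj "'i \<Rightarrow> ('r, 'i) fm option"

definition BigAnd :: "('r, 'i) fm set \<Rightarrow> ('r, 'i) fm" where
  "BigAnd A = Conj (SOME f. ran f = A)"

definition BigOr :: "('r, 'i) fm set \<Rightarrow> ('r, 'i) fm" where
  "BigOr A = Disj (SOME f. ran f = A)"

definition small :: "('r, 'i) fm set \<Rightarrow> bool" where
  "small A \<longleftrightarrow> |A| \<le>o |UNIV :: 'i set|"

lemma ran_enum:
  fixes A :: "('r, 'i) fm set"
  assumes "small A"
  shows "ran (SOME f :: 'i \<Rightarrow> ('r, 'i) fm option. ran f = A) = A"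
proof -
  obtain g :: "('r, 'i) fm \<Rightarrow> 'i" where g: "inj_on g A"
    using assms by (auto simp: small_def card_of_ordLeq[symmetric])
  define f where "f i = (if i \<in> g ` A then Some (the_inv_into A g i) else None)" for i
  have "ran f = the_inv_into A g ` g ` A"
    by (auto simp: ran_def f_def split: if_splits)
  also have "\<dots> = A"
    using g by (force simp: image_image the_inv_into_f_f)
  finally show ?thesis
    by (rule someI[where P = "\<lambda>f. ran f = A"])
qed

fun conjuncts :: "('r, 'i) fm \<Rightarrow> ('r, 'i) fm set" where
  "conjuncts (Conj f) = ran f"
| "conjuncts _ = {}"

lemma conjuncts_BigAnd: "small A \<Longrightarrow> conjuncts (BigAnd A) = A"
  by (simp add: BigAnd_def ran_enum)

lemma BigAnd_inject: "small A \<Longrightarrow> small B \<Longrightarrow> BigAnd A = BigAnd B \<longleftrightarrow> A = B"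
  by (metis conjuncts_BigAnd)

lemma BigOr_inject: "small A \<Longrightarrow> small B \<Longrightarrow> BigOr A = BigOr B \<longleftrightarrow> A = B"
  by (metis BigOr_def fm.inject(9) ran_enum)

text \<open>\<open>fml\<close> is the language with conjunctions and disjunctions of size at most
  \<open>\<kappa> = |'r| + |'o| + 2\<^bsup>\<aleph>\<^sub>0\<^esup> + |'k|\<close>, where \<open>'k\<close> is arbitrary.
  Thus \<open>'k\<close> accounts for the union over all \<open>\<kappa>\<close> in the language with conjunctions of
  any size, and the other summands make all conjunctions used below fit, for ordinals in
  \<open>'o\<close> and for structures whose universe is a set of elements of \<open>nat set\<close>.\<close>

type_synonym ('r, 'o, 'k) fml = "('r, 'r + 'o + nat set + 'k) fm"

fun lit_vars :: "('r, 'i) fm \<Rightarrow> nat set" where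
  "lit_vars (Rel R vs) = set vs"
| "lit_vars (Eq i j) = {i, j}"
| "lit_vars (Neg \<chi>) = lit_vars \<chi>"
| "lit_vars _ = {}"

fun lit_rename :: "(nat \<Rightarrow> nat) \<Rightarrow> ('r, 'i) fm \<Rightarrow> ('r, 'i) fm" where
  "lit_rename g (Rel R vs) = Rel R (map g vs)"
| "lit_rename g (Eq i j) = Eq (g i) (g j)"
| "lit_rename g (Neg \<chi>) = Neg (lit_rename g \<chi>)"
| "lit_rename g \<chi> = \<chi>"

definition atoms :: "('r \<Rightarrow> nat) \<Rightarrow> nat \<Rightarrow> ('r, 'i) fm set" where
  "atoms ar n = {Rel R vs | R vs. length vs = ar R \<and> set vs \<subseteq> {..<n}}
     \<union> {Eq i j | i j. i < n \<and> j < n}"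

section \<open>The formulas $\Psi^n_\alpha$\<close>

definition succ_fm :: "nat \<Rightarrow> ('r, 'i) fm \<Rightarrow> ('r, 'i) fm set \<Rightarrow> ('r, 'i) fm" where
  "succ_fm n \<phi> E = And \<phi> (And (BigAnd (Ex n ` E))
     (All n (Imp (BigAnd ((\<lambda>i. Neg (Eq n i)) ` {..<n})) (BigOr E))))"

fun first :: "('r, 'i) fm \<Rightarrow> ('r, 'i) fm" where
  "first (And \<phi> _) = \<phi>"
| "first \<phi> = \<phi>"

fun exts :: "('r, 'i) fm \<Rightarrow> ('r, 'i) fm set" where
  "exts (And _ (And _ (All _ (Imp _ (Disj f))))) = ran f"
| "exts _ = {}"

lemma first_succ_fm: "first (succ_fm n \<phi> E) = \<phi>"
  by (simp add: succ_fm_def)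

lemma exts_succ_fm: "small E \<Longrightarrow> exts (succ_fm n \<phi> E) = E"
  by (simp add: succ_fm_def BigOr_def ran_enum)

text \<open>At level 0 the identity of variables is decided as it is for tuples of distinct elements:
  \<open>x\<^sub>i = x\<^sub>i\<close> occurs positively, and \<open>x\<^sub>i = x\<^sub>j\<close> negatively for \<open>i \<noteq> j\<close>.\<close>

function Psi :: "('r \<Rightarrow> nat) \<Rightarrow> 'o::wellorder \<Rightarrow> nat \<Rightarrow> ('r, 'o, 'k) fml set" where
  "Psi ar \<alpha> n =
    (if zero_ord \<alpha> then
       {BigAnd ((\<lambda>\<chi>. if \<chi> \<in> P then \<chi> else Neg \<chi>) ` atoms ar n) | P.
          \<forall>i<n. \<forall>j<n. Eq i j \<in> P \<longleftrightarrow> i = j}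
     else if limit_ord \<alpha> then
       {BigAnd (\<psi> ` {..<\<alpha>}) | \<psi>.
          (\<forall>\<beta>. \<beta> < \<alpha> \<longrightarrow> \<psi> \<beta> \<in> Psi ar \<beta> n) \<and>
          (\<forall>\<beta> \<gamma>. succ_of \<beta> \<gamma> \<and> \<gamma> < \<alpha> \<longrightarrow> first (\<psi> \<gamma>) = \<psi> \<beta>) \<and>
          (\<forall>\<beta>. limit_ord \<beta> \<and> \<beta> < \<alpha> \<longrightarrow> \<psi> \<beta> = BigAnd (\<psi> ` {..<\<beta>}))}
     else
       {succ_fm n \<phi> E | \<phi> E.
          \<phi> \<in> Psi ar (pred_ord \<alpha>) n \<and> E \<subseteq> Psi ar (pred_ord \<alpha>) (Suc n) \<and> small E})"
  by pat_completeness auto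
termination
  by (relation "inv_image {(x, y). x < y} (\<lambda>(ar, \<alpha>, n). \<alpha>)")
     (auto simp: wf pred_ord_less intro!: wf_inv_image)

declare Psi.simps [simp del]

section \<open>Projections\<close>

text \<open>\<open>vproj ar \<alpha> \<beta>\<close> is $V_{\alpha,\beta}$, meaningful for \<open>\<alpha> \<le> \<beta>\<close>.\<close>

function vproj :: "('r \<Rightarrow> nat) \<Rightarrow> 'o::wellorder \<Rightarrow> 'o \<Rightarrow> ('r, 'o, 'k) fml \<Rightarrow> ('r, 'o, 'k) fml" where
  "vproj ar \<alpha> \<beta> \<phi> =
    (if \<alpha> = \<beta> \<or> zero_ord \<beta> then \<phi>
     else if limit_ord \<beta> then (THE \<psi>. \<psi> \<in> conjuncts \<phi> \<and> (\<exists>n. \<psi> \<in> Psi ar \<alpha> n))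
     else vproj ar \<alpha> (pred_ord \<beta>) (first \<phi>))"
  by pat_completeness auto
termination
  by (relation "inv_image {(x, y). x < y} (\<lambda>(ar, \<alpha>, \<beta>, \<phi>). \<beta>)")
     (auto simp: wf pred_ord_less intro!: wf_inv_image)

declare vproj.simps [simp del]

text \<open>An injection from $X_m$ to $X_n$ is represented by any \<open>j :: nat \<Rightarrow> nat\<close> that restricts to
  it; values outside \<open>{..<m}\<close> are irrelevant. So \<open>id\<close> represents all the inclusions $i_m$,
  and \<open>j(m := y)\<close> represents $j \cup \{(x_m,y)\}$.\<close>

definition injs :: "nat \<Rightarrow> nat \<Rightarrow> (nat \<Rightarrow> nat) set" where
  "injs m n = {j. inj_on j {..<m} \<and> j ` {..<m} \<subseteq> {..<n}}"

text \<open>\<open>hproj ar \<alpha> n m \<phi> j\<close> is $H^n_\alpha(\phi,j)$ for \<open>j \<in> injs m n\<close>.\<close>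

function hproj :: "('r \<Rightarrow> nat) \<Rightarrow> 'o::wellorder \<Rightarrow> nat \<Rightarrow> nat \<Rightarrow> ('r, 'o, 'k) fml \<Rightarrow> (nat \<Rightarrow> nat)
    \<Rightarrow> ('r, 'o, 'k) fml" where
  "hproj ar \<alpha> n m \<phi> j =
    (if zero_ord \<alpha> then
       BigAnd (lit_rename (the_inv_into {..<m} j) ` {\<chi> \<in> conjuncts \<phi>. lit_vars \<chi> \<subseteq> j ` {..<m}})
     else if limit_ord \<alpha> then
       BigAnd ((\<lambda>\<beta>. hproj ar \<beta> n m (vproj ar \<beta> \<alpha> \<phi>) j) ` {..<\<alpha>})
     else
       succ_fm m (hproj ar (pred_ord \<alpha>) n m (first \<phi>) j)
         ((\<lambda>(\<theta>, y). hproj ar (pred_ord \<alpha>) (Suc n) (Suc m) \<theta> (j(m := y)))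
            ` (exts \<phi> \<times> ({..<Suc n} - j ` {..<m}))))"
  by pat_completeness auto
termination
  by (relation "inv_image {(x, y). x < y} (\<lambda>(ar, \<alpha>, n, m, \<phi>, j). \<alpha>)")
     (auto simp: wf pred_ord_less intro!: wf_inv_image)

declare hproj.simps [simp del]

section \<open>Scott processes\<close>

definition level :: "('r \<Rightarrow> nat) \<Rightarrow> ('o::wellorder \<Rightarrow> ('r, 'o, 'k) fml set) \<Rightarrow> 'o \<Rightarrow> nat
    \<Rightarrow> ('r, 'o, 'k) fml set" where
  "level ar \<Phi> \<alpha> n = \<Phi> \<alpha> \<inter> Psi ar \<alpha> n"

text \<open>The length of the process is given as the initial segment \<open>I\<close> of its indices; the values of
  \<open>\<Phi>\<close> outside \<open>I\<close> are irrelevant.\<close>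

definition scott_process :: "('r \<Rightarrow> nat) \<Rightarrow> 'o::wellorder set \<Rightarrow> ('o \<Rightarrow> ('r, 'o, 'k) fml set) \<Rightarrow> bool"
  where
  "scott_process ar I \<Phi> \<longleftrightarrow>
    (\<forall>\<alpha>\<in>I. \<forall>\<beta><\<alpha>. \<beta> \<in> I) \<and>
    (\<forall>\<alpha>\<in>I. \<Phi> \<alpha> \<subseteq> (\<Union>n. Psi ar \<alpha> n)) \<and>
    (\<forall>\<alpha> \<beta>. succ_of \<alpha> \<beta> \<and> \<beta> \<in> I \<longrightarrow> (\<forall>\<phi>\<in>\<Phi> \<beta>. exts \<phi> \<subseteq> \<Phi> \<alpha>)) \<and>
    (\<forall>\<alpha> \<beta>. \<alpha> < \<beta> \<and> \<beta> \<in> I \<longrightarrow> \<Phi> \<alpha> = vproj ar \<alpha> \<beta> ` \<Phi> \<beta>) \<and>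
    (\<forall>\<alpha>\<in>I. \<forall>n. \<forall>\<phi>\<in>level ar \<Phi> \<alpha> n. \<forall>j\<in>injs n n. hproj ar \<alpha> n n \<phi> j \<in> level ar \<Phi> \<alpha> n) \<and>
    (\<forall>\<alpha>\<in>I. \<forall>m n. m < n \<longrightarrow> level ar \<Phi> \<alpha> m = (\<lambda>\<phi>. hproj ar \<alpha> n m \<phi> id) ` level ar \<Phi> \<alpha> n) \<and>
    (\<forall>\<alpha> \<beta>. succ_of \<alpha> \<beta> \<and> \<beta> \<in> I \<longrightarrow> (\<forall>n. \<forall>\<phi>\<in>level ar \<Phi> \<beta> n.
       exts \<phi> = vproj ar \<alpha> \<beta> `
         {\<psi> \<in> level ar \<Phi> \<beta> (Suc n). hproj ar \<beta> (Suc n) n \<psi> id = \<phi>})) \<and>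
    (\<forall>\<alpha> \<alpha>' \<beta>. succ_of \<alpha> \<alpha>' \<and> \<alpha> < \<beta> \<and> \<beta> \<in> I \<longrightarrow> (\<forall>n. \<forall>\<phi>\<in>level ar \<Phi> \<beta> n.
       exts (vproj ar \<alpha>' \<beta> \<phi>) \<subseteq> vproj ar \<alpha> \<beta> `
         {\<psi> \<in> level ar \<Phi> \<beta> (Suc n). hproj ar \<beta> (Suc n) n \<psi> id = \<phi>})) \<and>
    (\<forall>\<alpha>\<in>I. \<forall>n m. \<forall>\<phi>\<in>level ar \<Phi> \<alpha> n. \<forall>\<psi>\<in>level ar \<Phi> \<alpha> m.
       \<exists>\<theta>\<in>level ar \<Phi> \<alpha> (n + m). \<exists>j\<in>injs m (n + m).
         \<phi> = hproj ar \<alpha> (n + m) n \<theta> id \<and> \<psi> = hproj ar \<alpha> (n + m) m \<theta> j)"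

definition amalgamates :: "('r \<Rightarrow> nat) \<Rightarrow> 'o::wellorder \<Rightarrow> ('r, 'o, 'k) fml set \<Rightarrow> bool" where
  "amalgamates ar \<delta> \<Phi> \<longleftrightarrow>
    (\<forall>m n. m < n \<longrightarrow> (\<forall>\<phi> \<in> \<Phi> \<inter> Psi ar \<delta> (Suc m). \<forall>\<psi> \<in> \<Phi> \<inter> Psi ar \<delta> n.
       hproj ar \<delta> (Suc m) m \<phi> id = hproj ar \<delta> n m \<psi> id \<longrightarrow>
       (\<exists>\<theta> \<in> \<Phi> \<inter> Psi ar \<delta> (Suc n). \<exists>y \<in> {..<Suc n} - {..<m}.
          hproj ar \<delta> (Suc n) (Suc m) \<theta> (id(m := y)) = \<phi> \<and>
          hproj ar \<delta> (Suc n) n \<theta> id = \<psi>)))"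

section \<open>The Scott process of a structure\<close>

record ('r, 'm) struct =
  univ :: "'m set"
  interp :: "'r \<Rightarrow> 'm list set"

definition is_struct :: "('r \<Rightarrow> nat) \<Rightarrow> ('r, 'm) struct \<Rightarrow> bool" where
  "is_struct ar M \<longleftrightarrow> univ M \<noteq> {} \<and>
    (\<forall>R. interp M R \<subseteq> {as. length as = ar R \<and> set as \<subseteq> univ M})"

primrec sat :: "('r, 'm) struct \<Rightarrow> ('r, 'i) fm \<Rightarrow> (nat \<Rightarrow> 'm) \<Rightarrow> bool" where
  "sat M (Rel R vs) = (\<lambda>s. map s vs \<in> interp M R)"
| "sat M (Eq i j) = (\<lambda>s. s i = s j)"
| "sat M (Neg \<phi>) = (\<lambda>s. \<not> sat M \<phi> s)"
| "sat M (And \<phi> \<psi>) = (\<lambda>s. sat M \<phi> s \<and> sat M \<psi> s)"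
| "sat M (Imp \<phi> \<psi>) = (\<lambda>s. sat M \<phi> s \<longrightarrow> sat M \<psi> s)"
| "sat M (Ex n \<phi>) = (\<lambda>s. \<exists>c\<in>univ M. sat M \<phi> (s(n := c)))"
| "sat M (All n \<phi>) = (\<lambda>s. \<forall>c\<in>univ M. sat M \<phi> (s(n := c)))"
| "sat M (Conj f) = (\<lambda>s. \<forall>p \<in> ran (\<lambda>i. map_option (sat M) (f i)). p s)"
| "sat M (Disj f) = (\<lambda>s. \<exists>p \<in> ran (\<lambda>i. map_option (sat M) (f i)). p s)"

text \<open>\<open>tuple_fm ar M a \<alpha>\<close> is $\phi^M_{\bar a,\alpha}$, for a tuple given as a list
  of distinct elements.\<close>

function tuple_fm :: "('r \<Rightarrow> nat) \<Rightarrow> ('r, nat set) struct \<Rightarrow> nat set list \<Rightarrow> 'o::wellorder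
    \<Rightarrow> ('r, 'o, 'k) fml" where
  "tuple_fm ar M a \<alpha> =
    (if zero_ord \<alpha> then
       BigAnd {\<chi> \<in> atoms ar (length a) \<union> Neg ` atoms ar (length a). sat M \<chi> (\<lambda>i. a ! i)}
     else if limit_ord \<alpha> then
       BigAnd ((\<lambda>\<beta>. tuple_fm ar M a \<beta>) ` {..<\<alpha>})
     else
       succ_fm (length a) (tuple_fm ar M a (pred_ord \<alpha>))
         ((\<lambda>c. tuple_fm ar M (a @ [c]) (pred_ord \<alpha>)) ` (univ M - set a)))"
  by pat_completeness auto
termination
  by (relation "inv_image {(x, y). x < y} (\<lambda>(ar, M, a, \<alpha>). \<alpha>)")
     (auto simp: wf pred_ord_less intro!: wf_inv_image)

declare tuple_fm.simps [simp del]

definition struct_level :: "('r \<Rightarrow> nat) \<Rightarrow> ('r, nat set) struct \<Rightarrow> 'o::wellorder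
    \<Rightarrow> ('r, 'o, 'k) fml set" where
  "struct_level ar M \<alpha> = {tuple_fm ar M a \<alpha> | a. distinct a \<and> set a \<subseteq> univ M}"

end

theory Submission
  imports Defs "HOL-Library.Countable_Set"
begin

text \<open>
  Regard the formulas in the top level as types of finite tuples. If all tuples of distinct elements of
  a countable set have coherently been assigned types, and if \<open>\<phi>\<close> extends the type of a tuple
  \<open>a\<close> by one variable, then either \<open>\<phi>\<close> is already realized over \<open>a\<close>, or a new
  element realizing \<open>\<phi>\<close> can be added: one enumerates the countable set and amalgamates with
  one of its elements at a time; an amalgamation that identifies the new element with an old one
  would give a realization of \<open>\<phi>\<close>. As there are at most $\aleph_1$ types, a construction of
  length $\omega_1$, all of whose proper initial stages are countable, takes care of all pairs
  \<open>(a, \<phi>)\<close>. The types assigned to the tuples of the resulting structure are then, by induction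
  on the level, the formulas which the tuples satisfy.
\<close>

section \<open>Formulas and vertical projections\<close>

text \<open>The cardinality bound is shaped by the one-point step. Amalgamation concerns finite
  tuples only, so the type of a new element over an infinite set has to be assembled from types over
  finite subsets. An enumeration in order type \<omega> meets no intermediate limit, where the
  choices made so far would have to be continued over an infinite set; hence the step works over
  countable sets, and \<omega>_1 is the longest order type whose proper initial segments are all
  countable. The construction is organized by Zorn's lemma on partial constructions.
  \<open>cardSuc natLeq\<close> is a well-order on sets of naturals; its elements serve both as
  times and as points, which is why the universe consists of elements of type
  \<open>nat set\<close>. Only types in the top level are assigned: vertical projections commute
  with horizontal ones, so lower levels are determined. What makes the lower types correct is the
  pair of conditions on \<open>exts\<close>: an extension predicted at a lower level lifts to an
  extension of the full type, and every realized extension is predicted.\<close>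

lemma succ_of_not: "succ_of \<beta> \<alpha> \<Longrightarrow> \<not> zero_ord \<alpha> \<and> \<not> limit_ord \<alpha>"
  unfolding zero_ord_def limit_ord_def using succ_of_def leD by blast

lemma limit_not_zero: "limit_ord \<alpha> \<Longrightarrow> \<not> zero_ord \<alpha>"
  by (simp add: limit_ord_def)

lemma succ_le: "succ_of \<beta> \<alpha> \<Longrightarrow> \<gamma> < \<alpha> \<Longrightarrow> \<gamma> \<le> \<beta>"
  by (meson leD leI succ_of_def)

lemma succ_less: "succ_of \<beta> \<alpha> \<Longrightarrow> \<beta> < \<alpha>"
  by (simp add: succ_of_def)

lemma zero_ord_le: "zero_ord \<alpha> \<Longrightarrow> \<alpha> \<le> \<beta>"
  by (simp add: zero_ord_def)

lemma ord_induct [case_names zero succ limit]: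
  fixes \<alpha> :: "'o::wellorder"
  assumes "\<And>\<alpha>. zero_ord \<alpha> \<Longrightarrow> P \<alpha>"
    and "\<And>\<beta> \<alpha>. succ_of \<beta> \<alpha> \<Longrightarrow> P \<beta> \<Longrightarrow> P \<alpha>"
    and "\<And>\<alpha>. limit_ord \<alpha> \<Longrightarrow> (\<And>\<beta>. \<beta> < \<alpha> \<Longrightarrow> P \<beta>) \<Longrightarrow> P \<alpha>"
  shows "P \<alpha>"
proof (induction \<alpha> rule: less_induct)
  case (less \<alpha>)
  then show ?case
    using assms by (metis limit_ord_def succ_less)
qed

lemma ord_cases [case_names zero succ limit]:
  fixes \<alpha> :: "'o::wellorder"
  obtains "zero_ord \<alpha>" | \<beta> where "succ_of \<beta> \<alpha>" | "limit_ord \<alpha>"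
  by (auto simp: limit_ord_def)

section \<open>Cardinality bounds for the sets under a conjunction or disjunction\<close>

lemma infinite_index: "infinite (UNIV :: ('r + 'o + nat set + 'k) set)"
  by (simp add: flip: UNIV_Plus_UNIV Pow_UNIV)

lemma small_mono: "small B \<Longrightarrow> A \<subseteq> B \<Longrightarrow> small A"
  unfolding small_def by (meson card_of_mono1 ordLeq_transitive)

lemma small_imageI:
  "|A| \<le>o |UNIV :: 'i set| \<Longrightarrow> small (f ` A :: ('r, 'i) fm set)"
  unfolding small_def by (rule ordLeq_transitive[OF card_of_image])

lemma small_image: "small (A :: ('r, 'i) fm set) \<Longrightarrow> small (f ` A :: ('s, 'i) fm set)"
  by (rule small_imageI) (simp add: small_def)

text \<open>Serves the extension sets of horizontal projections, which are indexed by an old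
  extension together with one of finitely many positions.\<close>

lemma small_image_Times_finite:
  fixes A :: "('r, 'o, 'k) fml set"
  assumes "small A" "finite F"
  shows "small (f ` (A \<times> F) :: ('r, 'o, 'k) fml set)"
proof (rule small_imageI, rule card_of_Sigma_ordLeq_infinite)
  show "\<forall>x\<in>A. |F| \<le>o |UNIV :: ('r + 'o + nat set + 'k) set|"
    using assms(2) infinite_index by (meson card_of_Well_order card_of_ordLeq_finite ordLeq_total)
qed (use assms infinite_index in \<open>auto simp: small_def\<close>)

lemma small_image_ord: "small (f ` (A :: 'o set) :: ('r, 'o, 'k) fml set)"
proof (rule small_imageI)
  show "|A| \<le>o |UNIV :: ('r + 'o + nat set + 'k) set|"
    by (rule card_of_ordLeqI[where f = "\<lambda>x. Inr (Inl x)"]) (auto simp: inj_on_def)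
qed

lemma small_atoms: "small (atoms ar n :: ('r, 'o, 'k) fml set)"
proof -
  let ?U = "UNIV :: ('r + 'o + nat set + 'k) set"
  have c: "|A| \<le>o |?U|" if "countable A" for A :: "'a set"
  proof -
    have "|A| \<le>o |UNIV :: nat set|"
      using that by (auto simp: countable_def card_of_ordLeq[symmetric])
    then show ?thesis
      using infinite_index infinite_iff_card_of_nat ordLeq_transitive by blast
  qed
  have "|UNIV :: 'r set| \<le>o |?U|"
    by (rule card_of_ordLeqI[where f = Inl]) auto
  then have "|(UNIV :: 'r set) \<times> (UNIV :: nat list set)| \<le>o |?U|"
    by (intro card_of_Sigma_ordLeq_infinite infinite_index ballI c[of "UNIV :: nat list set"]) auto
  then have 1: "small ((\<lambda>(R, vs). Rel R vs) ` (UNIV \<times> UNIV) :: ('r, 'o, 'k) fml set)"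
    by (rule small_imageI)
  have 2: "small ((\<lambda>(i, j). Eq i j) ` UNIV :: ('r, 'o, 'k) fml set)"
    by (rule small_imageI, rule c) auto
  show ?thesis
  proof (rule small_mono)
    show "small ((\<lambda>(R, vs). Rel R vs) ` (UNIV \<times> UNIV)
        \<union> (\<lambda>(i, j). Eq i j) ` UNIV :: ('r, 'o, 'k) fml set)"
      using 1 2 unfolding small_def
      by (intro card_of_Un_ordLeq_infinite_Field[OF _ _ _ card_of_Card_order])
        (simp_all only: Field_card_of infinite_index not_False_eq_True)
  qed (auto simp: atoms_def image_iff)
qed

text \<open>\<open>P\<close> may be any set of formulas; only its trace on the atoms counts. Thanks
  to this freedom a horizontal projection at level zero merely replaces \<open>P\<close> by its
  preimage under a renaming, with no restriction to the remaining variables.\<close>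

definition base_fm :: "('r \<Rightarrow> nat) \<Rightarrow> nat \<Rightarrow> ('r, 'i) fm set \<Rightarrow> ('r, 'i) fm" where
  "base_fm ar n P = BigAnd ((\<lambda>\<chi>. if \<chi> \<in> P then \<chi> else Neg \<chi>) ` atoms ar n)"

lemma conjuncts_base_fm:
  "conjuncts (base_fm ar n P :: ('r, 'o, 'k) fml) = (\<lambda>\<chi>. if \<chi> \<in> P then \<chi> else Neg \<chi>) ` atoms ar n"
  unfolding base_fm_def by (rule conjuncts_BigAnd) (intro small_image small_atoms)

lemma atom_not_Neg: "Neg \<chi> \<notin> atoms ar n"
  by (auto simp: atoms_def)

text \<open>No atom is itself a negation, so a conjunct that enters negated is never mistaken for a
  positive one.\<close>

lemma atom_in_conjuncts_base_fm:
  fixes P :: "('r, 'o, 'k) fml set"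
  assumes "\<chi> \<in> atoms ar n"
  shows "\<chi> \<in> conjuncts (base_fm ar n P) \<longleftrightarrow> \<chi> \<in> P"
  using assms atom_not_Neg[of _ ar n] by (auto simp: conjuncts_base_fm)

lemma Psi_zero:
  "zero_ord \<alpha> \<Longrightarrow> Psi ar \<alpha> n = {base_fm ar n P | P. \<forall>i<n. \<forall>j<n. Eq i j \<in> P \<longleftrightarrow> i = j}"
  by (subst Psi.simps) (simp add: base_fm_def)

lemma Psi_succ:
  "succ_of \<beta> \<alpha> \<Longrightarrow>
    Psi ar \<alpha> n = {succ_fm n \<phi> E | \<phi> E. \<phi> \<in> Psi ar \<beta> n \<and> E \<subseteq> Psi ar \<beta> (Suc n) \<and> small E}"
  by (subst Psi.simps) (simp add: succ_of_not pred_ord_eq)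

lemma Psi_limit:
  "limit_ord \<alpha> \<Longrightarrow> Psi ar \<alpha> n =
     {BigAnd (\<psi> ` {..<\<alpha>}) | \<psi>.
          (\<forall>\<beta>. \<beta> < \<alpha> \<longrightarrow> \<psi> \<beta> \<in> Psi ar \<beta> n) \<and>
          (\<forall>\<beta> \<gamma>. succ_of \<beta> \<gamma> \<and> \<gamma> < \<alpha> \<longrightarrow> first (\<psi> \<gamma>) = \<psi> \<beta>) \<and>
          (\<forall>\<beta>. limit_ord \<beta> \<and> \<beta> < \<alpha> \<longrightarrow> \<psi> \<beta> = BigAnd (\<psi> ` {..<\<beta>}))}"
  by (subst Psi.simps) (simp add: limit_not_zero)

lemma conjuncts_BigAnd_ord:
  "conjuncts (BigAnd (\<psi> ` A) :: ('r, 'o, 'k) fml) = \<psi> ` (A :: 'o set)"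
  by (rule conjuncts_BigAnd[OF small_image_ord])

lemma Psi_succ_is_And: "succ_of \<beta> \<alpha> \<Longrightarrow> \<phi> \<in> Psi ar \<alpha> n \<Longrightarrow> \<exists>\<chi> \<chi>'. \<phi> = And \<chi> \<chi>'"
  by (auto simp: Psi_succ succ_fm_def)

lemma Psi_nonsucc_is_Conj:
  "zero_ord \<alpha> \<or> limit_ord \<alpha> \<Longrightarrow> \<phi> \<in> Psi ar \<alpha> n \<Longrightarrow> \<exists>f. \<phi> = Conj f"
  by (auto simp: Psi_zero Psi_limit base_fm_def BigAnd_def)

lemma first_in_Psi: "succ_of \<beta> \<alpha> \<Longrightarrow> \<phi> \<in> Psi ar \<alpha> n \<Longrightarrow> first \<phi> \<in> Psi ar \<beta> n"
  by (auto simp: Psi_succ first_succ_fm)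

text \<open>The head symbol separates successor levels (\<open>And\<close>) from zero and limit
  levels (\<open>Conj\<close>). Two successor levels are compared through first conjuncts, two limit
  levels through a conjunct that would itself lie on two different lower levels. The numbers of
  variables are kept independent, since \<open>vproj\<close> searches for a conjunct without knowing
  that number.\<close>

lemma Psi_disjoint_less:
  fixes \<alpha> \<beta> :: "'o::wellorder" and \<phi> :: "('r, 'o, 'k) fml"
  shows "\<alpha> < \<beta> \<Longrightarrow> \<phi> \<in> Psi ar \<alpha> n \<Longrightarrow> \<phi> \<in> Psi ar \<beta> m \<Longrightarrow> False"
proof (induction \<beta> arbitrary: \<alpha> \<phi> n m rule: less_induct)
  case (less \<beta>)
  show ?case
  proof (cases \<beta> rule: ord_cases)
    case zero
    then show ?thesis using less.prems(1) zero_ord_le leD by blast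
  next
    case (succ \<beta>')
    then obtain \<chi> \<chi>' where \<phi>: "\<phi> = And \<chi> \<chi>'"
      using Psi_succ_is_And less.prems(3) by blast
    then obtain \<alpha>' where \<alpha>': "succ_of \<alpha>' \<alpha>"
      using Psi_nonsucc_is_Conj[OF _ less.prems(2)]
      by (cases \<alpha> rule: ord_cases) auto
    have "first \<phi> \<in> Psi ar \<alpha>' n" "first \<phi> \<in> Psi ar \<beta>' m"
      using first_in_Psi \<alpha>' succ less.prems(2,3) by blast+
    moreover have "\<alpha>' < \<beta>'" "\<beta>' < \<beta>"
      using succ_less[OF succ] succ_less[OF \<alpha>'] succ_le[OF succ less.prems(1)]
      by auto
    ultimately show ?thesis
      using less.IH by blast
  next
    case limit
    then obtain \<psi> where \<psi>: "\<phi> = BigAnd (\<psi> ` {..<\<beta>})" "\<And>\<gamma>. \<gamma> < \<beta> \<Longrightarrow> \<psi> \<gamma> \<in> Psi ar \<gamma> m"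
      using less.prems(3) by (auto simp: Psi_limit)
    have cj: "conjuncts \<phi> = \<psi> ` {..<\<beta>}"
      unfolding \<psi>(1) by (rule conjuncts_BigAnd_ord)
    show ?thesis
    proof (cases \<alpha> rule: ord_cases)
      \<comment> \<open>All conjuncts of a level-zero formula are literals, whereas among the
        conjuncts of a formula at the limit \<beta> there is one of level zero, which is a
        \<open>Conj\<close>.\<close>
      case zero
      then obtain f where f: "\<psi> \<alpha> = Conj f"
        using \<psi>(2) less.prems(1) Psi_nonsucc_is_Conj by blast
      have "\<psi> \<alpha> \<in> conjuncts \<phi>"
        using cj less.prems(1) by auto
      then show False
        using less.prems(2) zero f by (auto simp: Psi_zero conjuncts_base_fm atoms_def split: if_splits)
    next
      case (succ \<alpha>')
      then show False
        using Psi_succ_is_And Psi_nonsucc_is_Conj limit less.prems by blast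
    next
      case limit': limit
      then obtain \<psi>' where \<psi>': "\<phi> = BigAnd (\<psi>' ` {..<\<alpha>})" "\<And>\<gamma>. \<gamma> < \<alpha> \<Longrightarrow> \<psi>' \<gamma> \<in> Psi ar \<gamma> n"
        using less.prems(2) by (auto simp: Psi_limit)
      \<comment> \<open>This conjunct of level \<alpha> must also occur in the representation at
        \<alpha>, hence at some level \<gamma> < \<alpha>; both levels lie below \<beta>.\<close>
      have "\<psi> \<alpha> \<in> conjuncts \<phi>"
        using cj less.prems(1) by auto
      then have "\<psi> \<alpha> \<in> \<psi>' ` {..<\<alpha>}"
        unfolding \<psi>'(1) conjuncts_BigAnd_ord .
      then obtain \<gamma> where "\<gamma> < \<alpha>" "\<psi> \<alpha> = \<psi>' \<gamma>"
        by auto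
      then show False
        using less.IH[OF less.prems(1), of \<gamma> "\<psi> \<alpha>" n m] \<psi>(2)[OF less.prems(1)] \<psi>'(2) by auto
    qed
  qed
qed

lemma Psi_disjoint: "\<phi> \<in> Psi ar \<alpha> n \<Longrightarrow> \<phi> \<in> Psi ar \<beta> m \<Longrightarrow> \<alpha> = \<beta>"
  by (metis Psi_disjoint_less linorder_cases)

section \<open>Vertical projections and coherent sequences\<close>

lemma vproj_refl [simp]: "vproj ar \<alpha> \<alpha> \<phi> = \<phi>"
  by (subst vproj.simps) simp

lemma vproj_succ: "succ_of \<beta> \<gamma> \<Longrightarrow> \<alpha> \<le> \<beta> \<Longrightarrow> vproj ar \<alpha> \<gamma> \<phi> = vproj ar \<alpha> \<beta> (first \<phi>)"
  using succ_of_not[of \<beta> \<gamma>] succ_less[of \<beta> \<gamma>] by (subst vproj.simps) (auto simp: pred_ord_eq)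

text \<open>Disjointness of the levels is what gives the definite description in
  \<open>vproj\<close> a unique referent.\<close>

lemma vproj_limit:
  fixes \<psi> :: "'o::wellorder \<Rightarrow> ('r, 'o, 'k) fml"
  assumes "limit_ord \<gamma>" "\<alpha> < \<gamma>" "\<And>\<beta>. \<beta> < \<gamma> \<Longrightarrow> \<psi> \<beta> \<in> Psi ar \<beta> n"
  shows "vproj ar \<alpha> \<gamma> (BigAnd (\<psi> ` {..<\<gamma>})) = \<psi> \<alpha>"
proof -
  have "(THE \<chi>. \<chi> \<in> \<psi> ` {..<\<gamma>} \<and> (\<exists>n. \<chi> \<in> Psi ar \<alpha> n)) = \<psi> \<alpha>"
  proof (rule the_equality)
    show "\<chi> = \<psi> \<alpha>" if "\<chi> \<in> \<psi> ` {..<\<gamma>} \<and> (\<exists>n. \<chi> \<in> Psi ar \<alpha> n)" for \<chi>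
      using that assms(3) Psi_disjoint by fastforce
  qed (use assms in auto)
  then show ?thesis
    using assms(1,2) limit_not_zero[OF assms(1)]
    by (subst vproj.simps) (auto simp: conjuncts_BigAnd_ord)
qed

text \<open>A uniform substitute for the separate clauses of \<open>Psi\<close> at successors and
  limits below a limit ordinal: compatibility is demanded along all vertical projections at once.
  \<open>Psi_limitE\<close> and \<open>Psi_limitI\<close> translate between the two forms.\<close>

definition coherent_seq :: "('r \<Rightarrow> nat) \<Rightarrow> nat \<Rightarrow> 'o::wellorder \<Rightarrow> ('o \<Rightarrow> ('r, 'o, 'k) fml) \<Rightarrow> bool" where
  "coherent_seq ar n \<gamma> \<psi> \<longleftrightarrow> (\<forall>\<beta><\<gamma>. \<psi> \<beta> \<in> Psi ar \<beta> n) \<and> (\<forall>\<alpha> \<beta>. \<alpha> \<le> \<beta> \<and> \<beta> < \<gamma> \<longrightarrow> vproj ar \<alpha> \<beta> (\<psi> \<beta>) = \<psi> \<alpha>)"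

lemma Psi_limitE:
  fixes \<phi> :: "('r, 'o::wellorder, 'k) fml"
  assumes lim: "limit_ord \<gamma>" and \<phi>: "\<phi> \<in> Psi ar \<gamma> n"
  obtains \<psi> where "coherent_seq ar n \<gamma> \<psi>" "\<phi> = BigAnd (\<psi> ` {..<\<gamma>})"
    "\<And>\<alpha>. \<alpha> < \<gamma> \<Longrightarrow> vproj ar \<alpha> \<gamma> \<phi> = \<psi> \<alpha>"
proof -
  obtain \<psi> where \<psi>: "\<phi> = BigAnd (\<psi> ` {..<\<gamma>})" "\<And>\<beta>. \<beta> < \<gamma> \<Longrightarrow> \<psi> \<beta> \<in> Psi ar \<beta> n"
    "\<And>\<beta> \<beta>'. succ_of \<beta> \<beta>' \<Longrightarrow> \<beta>' < \<gamma> \<Longrightarrow> first (\<psi> \<beta>') = \<psi> \<beta>"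
    "\<And>\<beta>. limit_ord \<beta> \<Longrightarrow> \<beta> < \<gamma> \<Longrightarrow> \<psi> \<beta> = BigAnd (\<psi> ` {..<\<beta>})"
    using \<phi> lim by (auto simp: Psi_limit)
  have "vproj ar \<alpha> \<beta> (\<psi> \<beta>) = \<psi> \<alpha>" if "\<alpha> \<le> \<beta>" "\<beta> < \<gamma>" for \<alpha> \<beta>
    using that
  proof (induction \<beta> rule: ord_induct)
    case (zero \<beta>)
    then have "\<alpha> = \<beta>" using zero_ord_le by (metis order_antisym)
    then show ?case by simp
  next
    case (succ \<beta>' \<beta>)
    show ?case
    proof (cases "\<alpha> = \<beta>")
      case False
      then have "\<alpha> \<le> \<beta>'"
        using succ by (meson order_le_less succ_le)
      moreover have "\<beta>' < \<gamma>"
        using succ by (meson order.strict_trans succ_less)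
      ultimately show ?thesis
        using succ \<psi>(3) by (simp add: vproj_succ)
    qed simp
  next
    case (limit \<beta>)
    show ?case
    proof (cases "\<alpha> = \<beta>")
      case False
      then show ?thesis
        using limit vproj_limit[of \<beta> \<alpha> \<psi> ar n] \<psi>(2,4) by (metis order.strict_trans order_le_less)
    qed simp
  qed
  then have "coherent_seq ar n \<gamma> \<psi>"
    using \<psi>(2) by (auto simp: coherent_seq_def)
  moreover have "\<And>\<alpha>. \<alpha> < \<gamma> \<Longrightarrow> vproj ar \<alpha> \<gamma> \<phi> = \<psi> \<alpha>"
    using vproj_limit[OF lim] \<psi>(1,2) by blast
  ultimately show thesis
    using that \<psi>(1) by blast
qed

lemma Psi_limit_eq:
  assumes "limit_ord \<gamma>" "\<phi> \<in> Psi ar \<gamma> n"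
  shows "BigAnd ((\<lambda>\<alpha>. vproj ar \<alpha> \<gamma> \<phi>) ` {..<\<gamma>}) = \<phi>"
proof -
  obtain \<psi> where \<psi>: "\<phi> = BigAnd (\<psi> ` {..<\<gamma>})" "\<And>\<alpha>. \<alpha> < \<gamma> \<Longrightarrow> vproj ar \<alpha> \<gamma> \<phi> = \<psi> \<alpha>"
    using Psi_limitE[OF assms] by metis
  then have "(\<lambda>\<alpha>. vproj ar \<alpha> \<gamma> \<phi>) ` {..<\<gamma>} = \<psi> ` {..<\<gamma>}"
    by (intro image_cong) auto
  then show ?thesis
    using \<psi>(1) by metis
qed

lemma Psi_limitI:
  assumes lim: "limit_ord \<gamma>" and \<psi>: "coherent_seq ar n \<gamma> \<psi>"
  shows "BigAnd (\<psi> ` {..<\<gamma>}) \<in> Psi ar \<gamma> n"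
proof -
  have "first (\<psi> \<beta>') = \<psi> \<beta>" if "succ_of \<beta> \<beta>'" "\<beta>' < \<gamma>" for \<beta> \<beta>'
    using \<psi> that unfolding coherent_seq_def
    by (metis order.strict_implies_order order_refl succ_less vproj_refl vproj_succ)
  moreover have "\<psi> \<beta> = BigAnd (\<psi> ` {..<\<beta>})" if "limit_ord \<beta>" "\<beta> < \<gamma>" for \<beta>
  proof -
    have "(\<lambda>\<alpha>. vproj ar \<alpha> \<beta> (\<psi> \<beta>)) ` {..<\<beta>} = \<psi> ` {..<\<beta>}"
      using that \<psi> by (intro image_cong) (auto simp: coherent_seq_def)
    then show ?thesis
      using Psi_limit_eq[OF that(1), of "\<psi> \<beta>" ar n] that(2) \<psi> by (simp add: coherent_seq_def)
  qed
  ultimately show ?thesis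
    using lim \<psi> by (auto simp: Psi_limit coherent_seq_def)
qed

lemma vproj_in_Psi: "\<alpha> \<le> \<beta> \<Longrightarrow> \<phi> \<in> Psi ar \<beta> n \<Longrightarrow> vproj ar \<alpha> \<beta> \<phi> \<in> Psi ar \<alpha> n"
proof (induction \<beta> arbitrary: \<phi> rule: ord_induct)
  case (zero \<beta>)
  then have "\<alpha> = \<beta>" using zero_ord_le by (metis order_antisym)
  then show ?case using zero by simp
next
  case (succ \<beta>' \<beta>)
  show ?case
  proof (cases "\<alpha> = \<beta>")
    case False
    then have "\<alpha> \<le> \<beta>'"
      using succ by (meson order_le_less succ_le)
    then show ?thesis
      using succ.IH[of "first \<phi>"] succ.hyps succ.prems(2) first_in_Psi[of \<beta>' \<beta> \<phi> ar n] by (simp add: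
          vproj_succ)
  qed (use succ in simp)
next
  case (limit \<beta>)
  show ?case
  proof (cases "\<alpha> = \<beta>")
    case False
    then have "\<alpha> < \<beta>"
      using limit by simp
    moreover obtain \<psi> where "coherent_seq ar n \<beta> \<psi>" "\<And>\<alpha>. \<alpha> < \<beta> \<Longrightarrow> vproj ar \<alpha> \<beta> \<phi> = \<psi> \<alpha>"
      using Psi_limitE[OF limit.hyps limit.prems(2)] by metis
    ultimately show ?thesis
      by (simp add: coherent_seq_def)
  qed (use limit in simp)
qed

lemma vproj_vproj:
  "\<alpha> \<le> \<beta> \<Longrightarrow> \<beta> \<le> \<gamma> \<Longrightarrow> \<phi> \<in> Psi ar \<gamma> n \<Longrightarrow> vproj ar \<alpha> \<beta> (vproj ar \<beta> \<gamma> \<phi>) = vproj ar \<alpha> \<gamma> \<phi>"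
proof (induction \<gamma> arbitrary: \<phi> rule: ord_induct)
  case (zero \<gamma>)
  then have "\<beta> = \<gamma>" using zero_ord_le by (metis order_antisym)
  then show ?case by simp
next
  case (succ \<gamma>' \<gamma>)
  show ?case
  proof (cases "\<beta> = \<gamma>")
    case False
    then have "\<beta> \<le> \<gamma>'"
      using succ by (meson order_le_less succ_le)
    then show ?thesis
      using succ.IH[of "first \<phi>"] succ.hyps succ.prems first_in_Psi[of \<gamma>' \<gamma> \<phi> ar n]
      by (simp add: vproj_succ)
  qed simp
next
  case (limit \<gamma>)
  show ?case
  proof (cases "\<beta> = \<gamma>")
    case False
    then have "\<alpha> < \<gamma>" "\<beta> < \<gamma>"
      using limit by auto
    moreover obtain \<psi> where "coherent_seq ar n \<gamma> \<psi>" "\<And>\<alpha>. \<alpha> < \<gamma> \<Longrightarrow> vproj ar \<alpha> \<gamma> \<phi> = \<psi> \<alpha>"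
      using Psi_limitE[OF limit.hyps limit.prems(3)] by metis
    ultimately show ?thesis
      using limit.prems(1) by (simp add: coherent_seq_def)
  qed simp
qed

section \<open>Horizontal projections\<close>

lemma hproj_zero:
  "zero_ord \<alpha> \<Longrightarrow> hproj ar \<alpha> n m \<phi> j =
    BigAnd (lit_rename (the_inv_into {..<m} j) ` {\<chi> \<in> conjuncts \<phi>. lit_vars \<chi> \<subseteq> j ` {..<m}})"
  by (subst hproj.simps) simp

lemma hproj_limit:
  "limit_ord \<alpha> \<Longrightarrow> hproj ar \<alpha> n m \<phi> j = BigAnd ((\<lambda>\<beta>. hproj ar \<beta> n m (vproj ar \<beta> \<alpha> \<phi>) j) ` {..<\<alpha>})"
  by (subst hproj.simps) (simp add: limit_not_zero)

lemma hproj_succ: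
  "succ_of \<beta> \<alpha> \<Longrightarrow> hproj ar \<alpha> n m \<phi> j =
     succ_fm m (hproj ar \<beta> n m (first \<phi>) j)
         ((\<lambda>(\<theta>, y). hproj ar \<beta> (Suc n) (Suc m) \<theta> (j(m := y)))
            ` (exts \<phi> \<times> ({..<Suc n} - j ` {..<m})))"
  by (subst hproj.simps) (simp add: succ_of_not pred_ord_eq)

section \<open>Renaming of literals and composition of injections\<close>

lemma lit_rename_comp: "lit_rename f (lit_rename g \<chi>) = lit_rename (f \<circ> g) \<chi>"
  by (induction \<chi>) auto

lemma lit_rename_cong: "(\<And>i. i \<in> lit_vars \<chi> \<Longrightarrow> f i = g i) \<Longrightarrow> lit_rename f \<chi> = lit_rename g \<chi>"
  by (induction \<chi>) auto

lemma lit_rename_ident: "lit_rename (\<lambda>i. i) \<chi> = \<chi>"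
  by (induction \<chi>) auto

lemma lit_rename_idI: "(\<And>i. i \<in> lit_vars \<chi> \<Longrightarrow> f i = i) \<Longrightarrow> lit_rename f \<chi> = \<chi>"
  using lit_rename_cong[of \<chi> f "\<lambda>i. i"] by (simp add: lit_rename_ident)

lemma lit_vars_rename: "lit_vars (lit_rename f \<chi>) = f ` lit_vars \<chi>"
  by (induction \<chi>) auto

lemma atoms_vars: "\<chi> \<in> atoms ar n \<Longrightarrow> lit_vars \<chi> \<subseteq> {..<n}"
  by (auto simp: atoms_def)

lemma lit_rename_atoms:
  "\<chi> \<in> atoms ar n \<Longrightarrow> f ` lit_vars \<chi> \<subseteq> {..<m} \<Longrightarrow> lit_rename f \<chi> \<in> atoms ar m"
  unfolding atoms_def by (auto simp: image_subset_iff subset_iff)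

lemma injs_comp: "j \<in> injs m n \<Longrightarrow> k \<in> injs l m \<Longrightarrow> j \<circ> k \<in> injs l n"
  unfolding injs_def by (auto simp: image_subset_iff inj_on_def)

lemma injs_le: "j \<in> injs m n \<Longrightarrow> m \<le> n"
  using card_inj_on_le[of j "{..<m}" "{..<n}"] by (auto simp: injs_def)

lemma injs_upd: "j \<in> injs m n \<Longrightarrow> y \<in> {..<Suc n} - j ` {..<m} \<Longrightarrow> j(m := y) \<in> injs (Suc m) (Suc n)"
  unfolding injs_def by (auto simp: image_subset_iff inj_on_def less_Suc_eq)

lemma injs_id: "m \<le> n \<Longrightarrow> id \<in> injs m n"
  by (auto simp: injs_def)

text \<open>On atoms over the range of \<open>j\<close>, renaming by the inverse of \<open>j\<close>
  undoes renaming by \<open>j\<close>, so the two sets of atoms correspond and signs are carried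
  along.\<close>

lemma hproj_base_fm:
  fixes P :: "('r, 'o::wellorder, 'k) fml set"
  assumes z: "zero_ord \<alpha>" and j: "j \<in> injs m n"
  shows "hproj ar \<alpha> n m (base_fm ar n P) j = base_fm ar m {\<chi>. lit_rename j \<chi> \<in> P}"
proof -
  let ?g = "the_inv_into {..<m} j"
  let ?lit = "\<lambda>P \<chi>. if \<chi> \<in> P then \<chi> else Neg \<chi>"
  have inv: "?g (j i) = i" if "i < m" for i
    using j that by (simp add: injs_def the_inv_into_f_f)
  have inv': "j (?g i) = i \<and> ?g i < m" if i: "i \<in> j ` {..<m}" for i
    using i inv by auto
  have bwd: "lit_rename ?g (lit_rename j \<chi>) = \<chi>" if "\<chi> \<in> atoms ar m" for \<chi> :: "('r, 'o, 'k) fml"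
    unfolding lit_rename_comp using atoms_vars[OF that] inv by (intro lit_rename_idI) auto
  have fwd: "lit_rename j (lit_rename ?g \<chi>) = \<chi>" "lit_rename ?g \<chi> \<in> atoms ar m"
    if "\<chi> \<in> atoms ar n" "lit_vars \<chi> \<subseteq> j ` {..<m}" for \<chi> :: "('r, 'o, 'k) fml"
    unfolding lit_rename_comp using that inv'
    by (auto intro!: lit_rename_idI lit_rename_atoms)
  have into: "lit_rename j \<chi> \<in> atoms ar n" "lit_vars (lit_rename j \<chi>) \<subseteq> j ` {..<m}"
    if "\<chi> \<in> atoms ar m" for \<chi> :: "('r, 'o, 'k) fml"
    using atoms_vars[OF that] j that by (auto simp: lit_vars_rename injs_def intro!: lit_rename_atoms)
  have "lit_rename ?g ` {\<chi> \<in> ?lit P ` atoms ar n. lit_vars \<chi> \<subseteq> j ` {..<m}} =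
    ?lit {\<chi>. lit_rename j \<chi> \<in> P} ` atoms ar m" (is "?l = ?r")
  proof (intro subset_antisym subsetI)
    fix \<chi> assume "\<chi> \<in> ?l"
    then obtain \<chi>' where \<chi>': "\<chi>' \<in> atoms ar n" "lit_vars \<chi>' \<subseteq> j ` {..<m}" "\<chi> = lit_rename ?g (?lit P \<chi>')"
      by (auto split: if_splits)
    then have "\<chi> = ?lit {\<chi>. lit_rename j \<chi> \<in> P} (lit_rename ?g \<chi>')"
      using fwd by auto
    then show "\<chi> \<in> ?r"
      using fwd \<chi>' by blast
  next
    fix \<chi> assume "\<chi> \<in> ?r"
    then obtain \<chi>' where \<chi>': "\<chi>' \<in> atoms ar m" "\<chi> = ?lit {\<chi>. lit_rename j \<chi> \<in> P} \<chi>'"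
      by auto
    let ?x = "?lit P (lit_rename j \<chi>')"
    have "\<chi> = lit_rename ?g ?x"
      using \<chi>' bwd by auto
    moreover have "?x \<in> {\<chi> \<in> ?lit P ` atoms ar n. lit_vars \<chi> \<subseteq> j ` {..<m}}"
      using into[OF \<chi>'(1)] by auto
    ultimately show "\<chi> \<in> ?l"
      by (simp only: imageI)
  qed
  then show ?thesis
    by (simp only: hproj_zero[OF z] conjuncts_base_fm base_fm_def[of ar m])
qed

lemma hproj_cong:
  fixes \<phi> :: "('r, 'o::wellorder, 'k) fml"
  shows "(\<And>i. i < m \<Longrightarrow> j i = k i) \<Longrightarrow> hproj ar \<alpha> n m \<phi> j = hproj ar \<alpha> n m \<phi> k"
proof (induction \<alpha> arbitrary: n m \<phi> j k rule: ord_induct)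
  case (zero \<alpha>)
  then have "j ` {..<m} = k ` {..<m}"
    by auto
  moreover have "the_inv_into {..<m} j = the_inv_into {..<m} k"
    unfolding the_inv_into_def using zero by (intro ext arg_cong[where f = The]) auto
  ultimately show ?case
    using zero.hyps by (simp add: hproj_zero)
next
  case (succ \<beta> \<alpha>)
  have "j ` {..<m} = k ` {..<m}"
    using succ.prems by auto
  moreover have "hproj ar \<beta> (Suc n) (Suc m) \<theta> (j(m := y)) =
      hproj ar \<beta> (Suc n) (Suc m) \<theta> (k(m := y))" for \<theta> :: "('r, 'o, 'k) fml" and y
    by (rule succ.IH[of "Suc m"]) (use succ.prems in \<open>auto simp: less_Suc_eq\<close>)
  moreover have "hproj ar \<beta> n m (first \<phi>) j = hproj ar \<beta> n m (first \<phi>) k"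
    by (rule succ.IH) (use succ.prems in auto)
  ultimately show ?case
    by (simp add: hproj_succ[OF succ.hyps])
next
  case (limit \<alpha>)
  have "(\<lambda>\<beta>. hproj ar \<beta> n m (vproj ar \<beta> \<alpha> \<phi>) j) ` {..<\<alpha>} =
      (\<lambda>\<beta>. hproj ar \<beta> n m (vproj ar \<beta> \<alpha> \<phi>) k) ` {..<\<alpha>}"
    by (intro image_cong refl limit.IH) (use limit.prems in auto)
  then show ?case
    by (simp only: hproj_limit[OF limit.hyps])
qed

lemma Psi_zeroE:
  assumes "zero_ord \<alpha>" "\<phi> \<in> Psi ar \<alpha> n"
  obtains P where "\<phi> = base_fm ar n P" "\<forall>i<n. \<forall>j<n. Eq i j \<in> P \<longleftrightarrow> i = j"
  using assms(2) unfolding Psi_zero[OF assms(1)] by blast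

lemma Psi_succE:
  assumes "succ_of \<beta> \<alpha>" "\<phi> \<in> Psi ar \<alpha> n"
  shows "first \<phi> \<in> Psi ar \<beta> n" "exts \<phi> \<subseteq> Psi ar \<beta> (Suc n)" "small (exts \<phi>)"
    "succ_fm n (first \<phi>) (exts \<phi>) = \<phi>"
  using assms by (auto simp: Psi_succ first_succ_fm exts_succ_fm)

lemma small_hproj_exts:
  "small (exts \<phi>) \<Longrightarrow>
    small ((\<lambda>(\<theta>, y). hproj ar \<beta> (Suc n) (Suc m) \<theta> (j(m := y))) ` (exts \<phi> \<times> ({..<Suc n} - j ` {..<m})))"
  by (rule small_image_Times_finite) auto

text \<open>The two claims need a joint induction: at a limit, membership requires the projected
  conjuncts to be coherent, which is commutation at lower levels, while extracting a conjunct again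
  requires membership of all of them.\<close>

lemma hproj_in_Psi_and_vproj_hproj:
  fixes \<phi> :: "('r, 'o::wellorder, 'k) fml"
  assumes "\<phi> \<in> Psi ar \<alpha> n" "j \<in> injs m n"
  shows "hproj ar \<alpha> n m \<phi> j \<in> Psi ar \<alpha> m \<and>
    (\<forall>\<beta>\<le>\<alpha>. vproj ar \<beta> \<alpha> (hproj ar \<alpha> n m \<phi> j) = hproj ar \<beta> n m (vproj ar \<beta> \<alpha> \<phi>) j)"
  using assms
proof (induction \<alpha> arbitrary: n m \<phi> j rule: ord_induct)
  case (zero \<alpha>)
  obtain P where P: "\<phi> = base_fm ar n P" "\<forall>i<n. \<forall>j<n. Eq i j \<in> P \<longleftrightarrow> i = j"
    using Psi_zeroE[OF zero.hyps zero.prems(1)] .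
  have "hproj ar \<alpha> n m \<phi> j = base_fm ar m {\<chi>. lit_rename j \<chi> \<in> P}"
    unfolding P(1) by (rule hproj_base_fm[OF zero.hyps zero.prems(2)])
  moreover have "\<forall>i<m. \<forall>i'<m. Eq i i' \<in> {\<chi>. lit_rename j \<chi> \<in> P} \<longleftrightarrow> i = i'"
  proof (intro allI impI)
    fix i i' assume "i < m" "i' < m"
    then have "j i < n" "j i' < n" "j i = j i' \<longleftrightarrow> i = i'"
      using zero.prems(2) by (auto simp: injs_def inj_on_def)
    then show "Eq i i' \<in> {\<chi>. lit_rename j \<chi> \<in> P} \<longleftrightarrow> i = i'"
      using P(2) by simp
  qed
  ultimately have "hproj ar \<alpha> n m \<phi> j \<in> Psi ar \<alpha> m"
    unfolding Psi_zero[OF zero.hyps] by blast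
  moreover have "\<beta> = \<alpha>" if "\<beta> \<le> \<alpha>" for \<beta>
    using that zero.hyps zero_ord_le by (metis order_antisym)
  ultimately show ?case
    by (metis vproj_refl)
next
  case (succ \<alpha>' \<alpha>)
  note \<phi> = Psi_succE[OF succ.hyps succ.prems(1)]
  let ?E = "(\<lambda>(\<theta>, y). hproj ar \<alpha>' (Suc n) (Suc m) \<theta> (j(m := y))) ` (exts \<phi> \<times> ({..<Suc n} - j ` {..<m}))"
  have E: "?E \<subseteq> Psi ar \<alpha>' (Suc m)" "small ?E"
    using succ.IH[of _ "Suc n" _
        "Suc m"] \<phi>(2) injs_upd[OF succ.prems(2)] small_hproj_exts[OF \<phi>(3)] by auto
  note IH = succ.IH[OF \<phi>(1) succ.prems(2)]
  have 1: "hproj ar \<alpha> n m \<phi> j \<in> Psi ar \<alpha> m"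
    using E IH by (auto simp: Psi_succ[OF succ.hyps] hproj_succ[OF succ.hyps])
  have "vproj ar \<beta> \<alpha> (hproj ar \<alpha> n m \<phi> j) = hproj ar \<beta> n m (vproj ar \<beta> \<alpha> \<phi>) j" if "\<beta> \<le> \<alpha>" for \<beta>
  proof (cases "\<beta> = \<alpha>")
    case False
    then have "\<beta> \<le> \<alpha>'"
      using that succ_le[OF succ.hyps] by simp
    then show ?thesis
      using IH by (simp add: vproj_succ[OF succ.hyps] hproj_succ[OF succ.hyps] first_succ_fm)
  qed simp
  with 1 show ?case
    by blast
next
  case (limit \<alpha>)
  let ?\<psi> = "\<lambda>\<beta>. hproj ar \<beta> n m (vproj ar \<beta> \<alpha> \<phi>) j"
  have V: "vproj ar \<beta> \<alpha> \<phi> \<in> Psi ar \<beta> n" if "\<beta> < \<alpha>" for \<beta>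
    using vproj_in_Psi that limit.prems(1) by (metis order_less_imp_le)
  have IH: "?\<psi> \<beta> \<in> Psi ar \<beta> m" "\<gamma> \<le> \<beta> \<Longrightarrow> vproj ar \<gamma> \<beta> (?\<psi> \<beta>) =
      hproj ar \<gamma> n m (vproj ar \<gamma> \<beta> (vproj ar \<beta> \<alpha> \<phi>)) j"
    if "\<beta> < \<alpha>" for \<beta> \<gamma>
    using limit.IH[OF that V[OF that] limit.prems(2)] by auto
  have "coherent_seq ar m \<alpha> ?\<psi>"
    unfolding coherent_seq_def
  proof (intro conjI allI impI)
    fix \<gamma> \<beta> assume "\<gamma> \<le> \<beta> \<and> \<beta> < \<alpha>"
    then show "vproj ar \<gamma> \<beta> (?\<psi> \<beta>) = ?\<psi> \<gamma>"
      using IH(2) vproj_vproj[of \<gamma> \<beta> \<alpha> \<phi> ar n] limit.prems(1) by (simp add: less_imp_le)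
  qed (use IH in auto)
  then have 1: "hproj ar \<alpha> n m \<phi> j \<in> Psi ar \<alpha> m"
    unfolding hproj_limit[OF limit.hyps] by (rule Psi_limitI[OF limit.hyps])
  have "vproj ar \<beta> \<alpha> (hproj ar \<alpha> n m \<phi> j) = ?\<psi> \<beta>" if "\<beta> \<le> \<alpha>" for \<beta>
  proof (cases "\<beta> = \<alpha>")
    case False
    then have "\<beta> < \<alpha>"
      using that by simp
    then show ?thesis
      unfolding hproj_limit[OF limit.hyps] using vproj_limit[OF limit.hyps _ IH(1)] by blast
  qed simp
  with 1 show ?case
    by blast
qed

lemma vproj_hproj:
  "\<phi> \<in> Psi ar \<alpha> n \<Longrightarrow> j \<in> injs m n \<Longrightarrow> \<beta> \<le> \<alpha> \<Longrightarrow>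
    vproj ar \<beta> \<alpha> (hproj ar \<alpha> n m \<phi> j) = hproj ar \<beta> n m (vproj ar \<beta> \<alpha> \<phi>) j"
  using hproj_in_Psi_and_vproj_hproj by blast

text \<open>Functoriality of restriction. The content is in the successor case: choosing first a
  value \<open>y\<close> for the new variable over \<open>j\<close> and then a value
  \<open>z\<close> over \<open>k\<close> must offer exactly the same positions as one choice over
  \<open>j \<circ> k\<close>.\<close>

lemma hproj_hproj:
  fixes \<phi> :: "('r, 'o::wellorder, 'k) fml"
  assumes "\<phi> \<in> Psi ar \<alpha> n" "j \<in> injs m n" "k \<in> injs l m"
  shows "hproj ar \<alpha> m l (hproj ar \<alpha> n m \<phi> j) k = hproj ar \<alpha> n l \<phi> (j \<circ> k)"
  using assms
proof (induction \<alpha> arbitrary: n m l \<phi> j k rule: ord_induct)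
  case (zero \<alpha>)
  obtain P where P: "\<phi> = base_fm ar n P"
    using Psi_zeroE[OF zero.hyps zero.prems(1)] .
  show ?case
    unfolding P
    by (simp only: hproj_base_fm[OF zero.hyps zero.prems(2)] hproj_base_fm[OF zero.hyps zero.prems(3)]
        hproj_base_fm[OF zero.hyps injs_comp[OF zero.prems(2,3)]] mem_Collect_eq lit_rename_comp)
next
  case (succ \<alpha>' \<alpha>)
  note \<phi> = Psi_succE[OF succ.hyps succ.prems(1)]
  note jk = succ.prems(2,3)
  let ?h = "\<lambda>\<theta>. hproj ar \<alpha>' (Suc n) (Suc l) \<theta>"
  let ?E = "(\<lambda>(\<theta>, y). hproj ar \<alpha>' (Suc n) (Suc m) \<theta> (j(m := y))) ` (exts \<phi> \<times> ({..<Suc n} - j ` {..<m}))"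
  let ?Y = "{..<Suc n} - j ` {..<m}" and ?Z = "{..<Suc m} - k ` {..<l}" and ?X =
      "{..<Suc n} - (j \<circ> k) ` {..<l}"
  have kl: "k ` {..<l} \<subseteq> {..<m}" and inj: "inj_on j {..<m}"
    using jk by (auto simp: injs_def)
  have step: "hproj ar \<alpha>' (Suc m) (Suc l) (hproj ar \<alpha>' (Suc n) (Suc m) \<theta> (j(m := y))) (k(l := z)) =
      ?h \<theta> ((j \<circ> k)(l := (j(m := y)) z))"
    if "\<theta> \<in> exts \<phi>" "y \<in> ?Y" "z \<in> ?Z" for \<theta> y z
  proof -
    have "hproj ar \<alpha>' (Suc m) (Suc l) (hproj ar \<alpha>' (Suc n) (Suc m) \<theta> (j(m := y))) (k(l := z)) =
        ?h \<theta> (j(m := y) \<circ> k(l := z))"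
      by (rule succ.IH[OF subsetD[OF \<phi>(2) that(1)] injs_upd[OF jk(1) that(2)] injs_upd[OF jk(2) that(3)]])
    also have "\<dots> = ?h \<theta> ((j \<circ> k)(l := (j(m := y)) z))"
      by (rule hproj_cong) (use kl in \<open>auto simp: less_Suc_eq image_subset_iff\<close>)
    finally show ?thesis .
  qed
  \<comment> \<open>Because m \<le> n, the range of \<open>j\<close> cannot exhaust n + 1
    positions.\<close>
  have Y: "\<exists>y. y \<in> ?Y"
  proof -
    have "card (j ` {..<m}) < card {..<Suc n}"
      using injs_le[OF jk(1)] inj by (simp add: card_image)
    then show ?thesis
      by (meson DiffI card_mono finite_imageI finite_lessThan leD subsetI)
  qed
  \<comment> \<open>A position outside the range of \<open>j\<close> is reached by taking it as
    \<open>y\<close> and \<open>z = m\<close>. One inside that range is \<open>j z\<close> for an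
    old \<open>z\<close>, with any \<open>y\<close> at all; for this \<open>?Y\<close> must be
    nonempty.\<close>
  have X: "(\<Union>y\<in>?Y. (j(m := y)) ` ?Z) = ?X"
  proof (intro subset_antisym subsetI)
    fix x assume "x \<in> (\<Union>y\<in>?Y. (j(m := y)) ` ?Z)"
    then obtain y z where yz: "y \<in> ?Y" "z \<in> ?Z" "x = (j(m := y)) z"
      by blast
    show "x \<in> ?X"
    proof (cases "z = m")
      case True
      then show ?thesis
        using yz kl by auto
    next
      case False
      then have "z < m" "z \<notin> k ` {..<l}" "x = j z"
        using yz by auto
      moreover have "j z \<notin> j ` k ` {..<l}"
        using inj kl calculation by (auto dest: inj_onD)
      moreover have "j z < n"
        using jk(1) \<open>z < m\<close> by (auto simp: injs_def)
      ultimately show ?thesis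
        by (simp add: image_comp)
    qed
  next
    fix x assume x: "x \<in> ?X"
    show "x \<in> (\<Union>y\<in>?Y. (j(m := y)) ` ?Z)"
    proof (cases "x \<in> j ` {..<m}")
      case True
      then obtain z where z: "x = j z" "z < m"
        by auto
      then have "z \<in> ?Z"
        using x by auto
      moreover obtain y where "y \<in> ?Y"
        using Y by blast
      ultimately show ?thesis
        using z by (intro UN_I[of y]) (auto intro!: image_eqI[of _ _ z])
    next
      case False
      then have "x \<in> ?Y"
        using x by simp
      moreover have "m \<in> ?Z"
        using kl by auto
      then have "x \<in> (j(m := x)) ` ?Z"
        by (rule rev_image_eqI) simp
      ultimately show ?thesis
        by blast
    qed
  qed
  have "(\<lambda>(\<theta>, z). hproj ar \<alpha>' (Suc m) (Suc l) \<theta> (k(l := z))) ` (?E \<times> ?Z) =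
    (\<Union>\<theta>\<in>exts \<phi>. \<Union>y\<in>?Y. \<Union>z\<in>?Z.
      {hproj ar \<alpha>' (Suc m) (Suc l) (hproj ar \<alpha>' (Suc n) (Suc m) \<theta> (j(m := y))) (k(l := z))})"
    by fast
  also have "\<dots> = (\<Union>\<theta>\<in>exts \<phi>. \<Union>y\<in>?Y. \<Union>z\<in>?Z. {?h \<theta> ((j \<circ> k)(l := (j(m := y)) z))})"
    using step by (intro SUP_cong refl) simp
  also have "\<dots> = (\<Union>\<theta>\<in>exts \<phi>. \<Union>x\<in>(\<Union>y\<in>?Y. (j(m := y)) ` ?Z). {?h \<theta> ((j \<circ> k)(l := x))})"
    by blast
  also have "\<dots> = (\<lambda>(\<theta>, x). ?h \<theta> ((j \<circ> k)(l := x))) ` (exts \<phi> \<times> ?X)"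
    unfolding X by fast
  finally have E: "(\<lambda>(\<theta>, z). hproj ar \<alpha>' (Suc m) (Suc l) \<theta> (k(l := z))) ` (?E \<times> ?Z) =
    (\<lambda>(\<theta>, x). ?h \<theta> ((j \<circ> k)(l := x))) ` (exts \<phi> \<times> ?X)" .
  show ?case
    by (simp only: hproj_succ[OF succ.hyps] first_succ_fm exts_succ_fm[OF small_hproj_exts[OF \<phi>(3)]]
        E succ.IH[OF \<phi>(1) jk])
next
  case (limit \<alpha>)
  have "hproj ar \<beta> m l (vproj ar \<beta> \<alpha> (hproj ar \<alpha> n m \<phi> j)) k = hproj ar \<beta> n l (vproj ar \<beta> \<alpha> \<phi>) (j \<circ> k)"
    if "\<beta> < \<alpha>" for \<beta>
    by (simp only: vproj_hproj[OF limit.prems(1,2) less_imp_le[OF that]]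
        limit.IH[OF that vproj_in_Psi[OF less_imp_le[OF that] limit.prems(1)] limit.prems(2,3)])
  then have "(\<lambda>\<beta>. hproj ar \<beta> m l (vproj ar \<beta> \<alpha> (hproj ar \<alpha> n m \<phi> j)) k) ` {..<\<alpha>} =
    (\<lambda>\<beta>. hproj ar \<beta> n l (vproj ar \<beta> \<alpha> \<phi>) (j \<circ> k)) ` {..<\<alpha>}"
    by (intro image_cong) auto
  then show ?case
    by (simp only: hproj_limit[OF limit.hyps])
qed

lemma hproj_id:
  fixes \<phi> :: "('r, 'o::wellorder, 'k) fml"
  assumes "\<phi> \<in> Psi ar \<alpha> n"
  shows "hproj ar \<alpha> n n \<phi> id = \<phi>"
  using assms
proof (induction \<alpha> arbitrary: n \<phi> rule: ord_induct)
  case (zero \<alpha>)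
  then obtain P where "\<phi> = base_fm ar n P"
    by (rule Psi_zeroE)
  moreover have "lit_rename id \<chi> = \<chi>" for \<chi> :: "('r, 'o, 'k) fml"
    by (rule lit_rename_idI) simp
  ultimately show ?case
    by (simp only: hproj_base_fm[OF zero.hyps injs_id[OF order_refl]] Collect_mem_eq)
next
  case (succ \<alpha>' \<alpha>)
  note \<phi> = Psi_succE[OF succ.hyps succ.prems(1)]
  have Y: "{..<Suc n} - id ` {..<n} = {n}"
    by auto
  have "hproj ar \<alpha>' (Suc n) (Suc n) \<theta> (id(n := n)) = \<theta>" if "\<theta> \<in> exts \<phi>" for \<theta>
    using succ.IH \<phi>(2) that by (metis fun_upd_triv id_apply subsetD)
  then have "(\<lambda>(\<theta>, y). hproj ar \<alpha>' (Suc n) (Suc n) \<theta> (id(n := y))) ` (exts \<phi> \<times> {n}) = exts \<phi>"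
    by force
  then show ?case
    using Y succ.IH[OF \<phi>(1)] \<phi>(4) by (simp only: hproj_succ[OF succ.hyps])
next
  case (limit \<alpha>)
  have "(\<lambda>\<beta>. hproj ar \<beta> n n (vproj ar \<beta> \<alpha> \<phi>) id) ` {..<\<alpha>} = (\<lambda>\<beta>. vproj ar \<beta> \<alpha> \<phi>) ` {..<\<alpha>}"
    by (intro image_cong refl limit.IH vproj_in_Psi[OF _ limit.prems(1)]) auto
  then show ?case
    using Psi_limit_eq[OF limit.hyps limit.prems] by (simp only: hproj_limit[OF limit.hyps])
qed

section \<open>Coherent assignments of types\<close>

definition pos :: "'a list \<Rightarrow> 'a \<Rightarrow> nat" where
  "pos l x = (THE i. i < length l \<and> l ! i = x)"

lemma pos_nth: "distinct l \<Longrightarrow> i < length l \<Longrightarrow> pos l (l ! i) = i"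
  unfolding pos_def by (rule the_equality) (auto simp: nth_eq_iff_index_eq)

lemma nth_pos: "distinct l \<Longrightarrow> x \<in> set l \<Longrightarrow> pos l x < length l \<and> l ! pos l x = x"
  by (metis in_set_conv_nth pos_nth)

lemma injs_pos:
  assumes "distinct l" "distinct b" "set b \<subseteq> set l"
  shows "(\<lambda>i. pos l (b ! i)) \<in> injs (length b) (length l)"
proof -
  have mem: "b ! i \<in> set l" if "i < length b" for i
    using assms(3) nth_mem[OF that] by (rule subsetD)
  have "i = i'" if i: "i < length b" "i' < length b" "pos l (b ! i) = pos l (b ! i')" for i i'
  proof -
    have "b ! i = b ! i'"
      using nth_pos[OF assms(1) mem[OF i(1)]] nth_pos[OF assms(1) mem[OF i(2)]] i(3) by metis
    then show ?thesis
      using assms(2) i(1,2) by (simp add: nth_eq_iff_index_eq)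
  qed
  moreover have "pos l (b ! i) < length l" if "i < length b" for i
    using nth_pos[OF assms(1) mem[OF that]] by simp
  ultimately show ?thesis
    by (auto simp: injs_def inj_on_def)
qed

text \<open>All that the construction uses of the top level: types with restriction along
  injections. Amalgamation enters only for two one-point extensions of a common type; the
  alternative \<phi> = \<psi> is the case where the two new points are identified.\<close>

locale type_system =
  fixes L :: "nat \<Rightarrow> 'p set" and H :: "nat \<Rightarrow> nat \<Rightarrow> 'p \<Rightarrow> (nat \<Rightarrow> nat) \<Rightarrow> 'p"
  assumes H_in: "\<phi> \<in> L n \<Longrightarrow> j \<in> injs m n \<Longrightarrow> H n m \<phi> j \<in> L m"
    and H_cong: "(\<And>i. i < m \<Longrightarrow> j i = k i) \<Longrightarrow> H n m \<phi> j = H n m \<phi> k"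
    and H_comp: "\<phi> \<in> L n \<Longrightarrow> j \<in> injs m n \<Longrightarrow> k \<in> injs l m \<Longrightarrow> H m l (H n m \<phi> j) k = H n l \<phi> (j \<circ> k)"
    and H_id: "\<phi> \<in> L n \<Longrightarrow> H n n \<phi> id = \<phi>"
    and L_0: "\<exists>\<phi>. L 0 = {\<phi>}"
    and amalg: "\<phi> \<in> L (Suc n) \<Longrightarrow> \<psi> \<in> L (Suc n) \<Longrightarrow> H (Suc n) n \<phi> id = H (Suc n) n \<psi> id \<Longrightarrow>
      \<phi> = \<psi> \<or> (\<exists>\<theta>\<in>L (Suc (Suc n)). H (Suc (Suc n)) (Suc n) \<theta> (id(n := Suc n)) = \<phi> \<and>
        H (Suc (Suc n)) (Suc n) \<theta> id = \<psi>)"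
    and card_L: "|\<Union>n. L n| \<le>o cardSuc natLeq"
begin

text \<open>If \<open>\<phi>\<close> is the type of the tuple \<open>l\<close>, then \<open>tp l \<phi> b\<close> is the type of the
  tuple \<open>b\<close> of elements of \<open>l\<close>.\<close>

definition tp :: "'a list \<Rightarrow> 'p \<Rightarrow> 'a list \<Rightarrow> 'p" where
  "tp l \<phi> b = H (length l) (length b) \<phi> (\<lambda>i. pos l (b ! i))"

lemma tp_in:
  "\<phi> \<in> L (length l) \<Longrightarrow> distinct l \<Longrightarrow> distinct b \<Longrightarrow> set b \<subseteq> set l \<Longrightarrow> tp l \<phi> b \<in> L (length b)"
  unfolding tp_def by (intro H_in injs_pos)

lemma tp_tp:
  assumes "\<phi> \<in> L (length l)" "distinct l" "distinct b" "distinct c" "set b \<subseteq> set l" "set c \<subseteq> set b"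
  shows "tp b (tp l \<phi> b) c = tp l \<phi> c"
proof -
  have "tp b (tp l \<phi> b) c = H (length l) (length c) \<phi> ((\<lambda>i. pos l (b ! i)) \<circ> (\<lambda>i. pos b (c ! i)))"
    unfolding tp_def using assms by (intro H_comp injs_pos)
  also have "\<dots> = tp l \<phi> c"
    unfolding tp_def
  proof (rule H_cong)
    fix i assume "i < length c"
    then have "b ! pos b (c ! i) = c ! i"
      using nth_pos[OF assms(3), of "c ! i"] assms(6) nth_mem by blast
    then show "((\<lambda>i. pos l (b ! i)) \<circ> (\<lambda>i. pos b (c ! i))) i = pos l (c ! i)"
      by simp
  qed
  finally show ?thesis .
qed

lemma tp_prefix:
  assumes "distinct (l @ l')"
  shows "tp (l @ l') \<phi> l = H (length l + length l') (length l) \<phi> id"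
  unfolding tp_def length_append
proof (rule H_cong)
  fix i assume "i < length l"
  then show "pos (l @ l') (l ! i) = id i"
    using pos_nth[OF assms, of i] by (simp add: nth_append)
qed

lemma tp_self: "\<phi> \<in> L (length l) \<Longrightarrow> distinct l \<Longrightarrow> tp l \<phi> l = \<phi>"
  using tp_prefix[of l "[]"] by (simp add: H_id)

text \<open>Identifies the second restriction map in \<open>amalg\<close> as the deletion of the
  next to last entry.\<close>

lemma tp_skip:
  assumes "distinct (l @ [x, y])"
  shows "tp (l @ [x, y]) \<phi> (l @ [y]) =
      H (Suc (Suc (length l))) (Suc (length l)) \<phi> (id(length l := Suc (length l)))"
proof -
  have "H (Suc (Suc (length l))) (Suc (length l)) \<phi> (\<lambda>i. pos (l @ [x, y]) ((l @ [y]) ! i)) =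
    H (Suc (Suc (length l))) (Suc (length l)) \<phi> (id(length l := Suc (length l)))"
  proof (rule H_cong)
    fix i assume i: "i < Suc (length l)"
    have "(l @ [y]) ! i = (l @ [x, y]) ! (id(length l := Suc (length l))) i"
      using i by (auto simp: nth_append less_Suc_eq)
    moreover have "(id(length l := Suc (length l))) i < length (l @ [x, y])"
      using i by auto
    ultimately show "pos (l @ [x, y]) ((l @ [y]) ! i) = (id(length l := Suc (length l))) i"
      using pos_nth[OF assms] by metis
  qed
  then show ?thesis
    by (simp add: tp_def)
qed

text \<open>The assignment is given by its graph, so that extending it is inclusion and the limit of
  a chain is a union. Only tuples without repetition carry types.\<close>

definition coherent :: "'a set \<Rightarrow> ('a list \<times> 'p) set \<Rightarrow> bool" where
  "coherent D P \<longleftrightarrow>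
    (\<forall>a \<phi>. (a, \<phi>) \<in> P \<longrightarrow> distinct a \<and> set a \<subseteq> D \<and> \<phi> \<in> L (length a)) \<and>
    (\<forall>a. distinct a \<and> set a \<subseteq> D \<longrightarrow> (\<exists>\<phi>. (a, \<phi>) \<in> P)) \<and>
    (\<forall>a \<phi> b. (a, \<phi>) \<in> P \<and> distinct b \<and> set b \<subseteq> set a \<longrightarrow> (b, tp a \<phi> b) \<in> P) \<and>
    single_valued P"

lemma coherentD:
  assumes "coherent D P"
  shows "(a, \<phi>) \<in> P \<Longrightarrow> distinct a" "(a, \<phi>) \<in> P \<Longrightarrow> set a \<subseteq> D" "(a, \<phi>) \<in> P \<Longrightarrow> \<phi> \<in> L (length a)"
    "distinct a \<Longrightarrow> set a \<subseteq> D \<Longrightarrow> \<exists>\<phi>. (a, \<phi>) \<in> P"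
    "(a, \<phi>) \<in> P \<Longrightarrow> distinct b \<Longrightarrow> set b \<subseteq> set a \<Longrightarrow> (b, tp a \<phi> b) \<in> P"
    "(a, \<phi>) \<in> P \<Longrightarrow> (a, \<psi>) \<in> P \<Longrightarrow> \<phi> = \<psi>"
  using assms unfolding coherent_def single_valued_def by blast+

lemma coherent_tp:
  "coherent D P \<Longrightarrow> (a, \<phi>) \<in> P \<Longrightarrow> (b, \<psi>) \<in> P \<Longrightarrow> set b \<subseteq> set a \<Longrightarrow> \<psi> = tp a \<phi> b"
  using coherentD(1,5,6) by metis

section \<open>One-point extensions over a countable set\<close>

lemma amalg_tp:
  assumes d: "distinct (l @ [x, y])" and \<phi>: "\<phi> \<in> L (Suc (length l))" "\<psi> \<in> L (Suc (length l))"
    and eq: "tp (l @ [x]) \<phi> l = tp (l @ [y]) \<psi> l" and ne: "\<phi> \<noteq> \<psi>"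
  obtains \<theta> where "\<theta> \<in> L (Suc (Suc (length l)))" "tp (l @ [x, y]) \<theta> (l @ [x]) = \<phi>"
    "tp (l @ [x, y]) \<theta> (l @ [y]) = \<psi>"
proof -
  have "H (Suc (length l)) (length l) \<psi> id = H (Suc (length l)) (length l) \<phi> id"
    using eq d tp_prefix[of l "[x]" \<phi>] tp_prefix[of l "[y]" \<psi>] by simp
  then obtain \<theta> where "\<theta> \<in> L (Suc (Suc (length l)))"
    "H (Suc (Suc (length l))) (Suc (length l)) \<theta> (id(length l := Suc (length l))) = \<psi>"
    "H (Suc (Suc (length l))) (Suc (length l)) \<theta> id = \<phi>"
    using amalg[OF \<phi>(2,1)] ne by blast
  then show thesis
    using that[of \<theta>] tp_skip[OF d] tp_prefix[of "l @ [x]" "[y]" \<theta>] d by simp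
qed

text \<open>The invariant of the enumeration is that \<theta>, the intended type of
  \<open>l @ [w]\<close>, has no realization in \<open>D\<close>. Hence it differs from the type of
  \<open>l @ [x]\<close>, and the amalgam keeps \<open>w\<close> apart from \<open>x\<close>. The
  invariant is inherited: from a realization of \<open>\<theta>'\<close>, deletion of
  \<open>x\<close> would give one of \<theta>.\<close>

lemma amalg_step:
  assumes coh: "coherent D P" and w: "w \<notin> D" and l: "distinct l" "set l \<subseteq> D"
    and x: "x \<in> D" "x \<notin> set l"
    and \<theta>: "\<theta> \<in> L (Suc (length l))" "(l, tp (l @ [w]) \<theta> l) \<in> P"
    and nr: "\<And>c. c \<in> D \<Longrightarrow> (l @ [c], \<theta>) \<notin> P"
  obtains \<theta>' where "\<theta>' \<in> L (Suc (Suc (length l)))" "(l @ [x], tp (l @ [x, w]) \<theta>' (l @ [x])) \<in> P"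
    "\<And>c. c \<in> D \<Longrightarrow> (l @ [x, c], \<theta>') \<notin> P" "tp (l @ [x, w]) \<theta>' (l @ [w]) = \<theta>"
proof -
  have d: "distinct (l @ [x, w])"
    using l x w by auto
  obtain \<chi> where \<chi>: "(l @ [x], \<chi>) \<in> P"
    using coherentD(4)[OF coh, of "l @ [x]"] l x by auto
  have "tp (l @ [x]) \<chi> l = tp (l @ [w]) \<theta> l"
    using coherent_tp[OF coh \<chi> \<theta>(2)] by (simp add: subset_insertI)
  moreover have "\<chi> \<noteq> \<theta>"
    using nr[OF x(1)] \<chi> by auto
  moreover have "\<chi> \<in> L (Suc (length l))"
    using coherentD(3)[OF coh \<chi>] by simp
  ultimately obtain \<theta>' where \<theta>': "\<theta>' \<in> L (Suc (Suc (length l)))" "tp (l @ [x, w]) \<theta>' (l @ [x]) = \<chi>"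
    "tp (l @ [x, w]) \<theta>' (l @ [w]) = \<theta>"
    using amalg_tp[OF d _ \<theta>(1)] by metis
  have "(l @ [x, c], \<theta>') \<notin> P" if c: "c \<in> D" for c
  proof
    assume P: "(l @ [x, c], \<theta>') \<in> P"
    note d' = coherentD(1)[OF coh P]
    have "(l @ [c], tp (l @ [x, c]) \<theta>' (l @ [c])) \<in> P"
      using coherentD(5)[OF coh P, of "l @ [c]"] d' by auto
    moreover have "tp (l @ [x, c]) \<theta>' (l @ [c]) = \<theta>"
      using \<theta>'(3) tp_skip[OF d] tp_skip[OF d'] by simp
    ultimately show False
      using nr c by simp
  qed
  then show thesis
    using that[of \<theta>'] \<theta>' \<chi> by simp
qed

text \<open>Finite lists \<open>l k\<close> exhaust \<open>D\<close>, starting from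
  \<open>a\<close>; the types of \<open>l k @ [w]\<close> are chosen successively, each restricting
  to its predecessor, and together they decide every tuple over \<open>insert w D\<close>.\<close>

lemma one_point_extension:
  assumes coh: "coherent D P" and D: "countable D" and w: "w \<notin> D"
    and a: "(a, H (Suc (length a)) (length a) \<phi> id) \<in> P" and \<phi>: "\<phi> \<in> L (Suc (length a))"
    and nr: "\<And>c. c \<in> D \<Longrightarrow> (a @ [c], \<phi>) \<notin> P"
  obtains P' where "P \<subseteq> P'" "coherent (insert w D) P'" "(a @ [w], \<phi>) \<in> P'"
proof -
  \<comment> \<open>If \<open>D\<close> is empty, \<open>d\<close> has values outside it, hence the
    test \<open>d k \<in> D\<close> in the recursion.\<close>
  obtain d :: "nat \<Rightarrow> 'a" where d: "D \<subseteq> range d"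
    using D by (metis empty_subsetI range_from_nat_into subset_refl)
  define l where "l = rec_nat a (\<lambda>k xs. if d k \<in> D \<and> d k \<notin> set xs then xs @ [d k] else xs)"
  have l_0: "l 0 = a" and l_Suc: "l (Suc k) = (if d k \<in> D \<and>
      d k \<notin> set (l k) then l k @ [d k] else l k)" for k
    by (simp_all add: l_def)
  have l: "distinct (l k) \<and> set (l k) \<subseteq> D" for k
    using coherentD(1,2)[OF coh a] by (induction k) (auto simp: l_0 l_Suc)
  have lw: "distinct (l k @ [w])" for k
    using l[of k] w by auto
  have l_mono: "k \<le> k' \<Longrightarrow> set (l k) \<subseteq> set (l k')" for k k'
    by (rule lift_Suc_mono_le[of "\<lambda>k. set (l k)"]) (auto simp: l_Suc)
  have d_in: "d k \<in> D \<Longrightarrow> d k \<in> set (l (Suc k))" for k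
    by (simp add: l_Suc)
  have cover: "\<exists>k. B \<subseteq> insert w (set (l k))" if "finite B" "B \<subseteq> insert w D" for B
    using that
  proof (induction B rule: finite_induct)
    case (insert x B)
    then obtain k where k: "B \<subseteq> insert w (set (l k))"
      by auto
    show ?case
    proof (cases "x = w")
      case False
      then obtain k' where "x = d k'"
        using insert.prems d by auto
      then have "x \<in> set (l (Suc k'))"
        using insert.prems False d_in by auto
      then have "insert x B \<subseteq> insert w (set (l (max k (Suc k'))))"
        using k l_mono[of k "max k (Suc k')"] l_mono[of "Suc k'" "max k (Suc k')"] by auto
      then show ?thesis
        by blast
    qed (use k in blast)
  qed auto
  \<comment> \<open>The clause for \<open>k = 0\<close> pins the first term to \<phi>, which
    dependent choice would otherwise leave free.\<close>
  have "\<exists>\<theta>. \<forall>k. (\<theta> k \<in> L (Suc (length (l k))) \<and> (l k, tp (l k @ [w]) (\<theta> k) (l k)) \<in> P \<and>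
      (\<forall>c\<in>D. (l k @ [c], \<theta> k) \<notin> P) \<and> (k = 0 \<longrightarrow> \<theta> k = \<phi>)) \<and>
      tp (l (Suc k) @ [w]) (\<theta> (Suc k)) (l k @ [w]) = \<theta> k"
  proof (rule dependent_nat_choice)
    have "tp (a @ [w]) \<phi> a = H (Suc (length a)) (length a) \<phi> id"
      using tp_prefix[of a "[w]" \<phi>] lw[of 0] l_0 by simp
    then show "\<exists>\<theta>. \<theta> \<in> L (Suc (length (l 0))) \<and> (l 0, tp (l 0 @ [w]) \<theta> (l 0)) \<in> P \<and>
      (\<forall>c\<in>D. (l 0 @ [c], \<theta>) \<notin> P) \<and> (0 = (0::nat) \<longrightarrow> \<theta> = \<phi>)"
      using \<phi> a nr by (auto simp: l_0)
  next
    fix \<theta> k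
    assume \<theta>: "\<theta> \<in> L (Suc (length (l k))) \<and> (l k, tp (l k @ [w]) \<theta> (l k)) \<in> P \<and>
      (\<forall>c\<in>D. (l k @ [c], \<theta>) \<notin> P) \<and> (k = 0 \<longrightarrow> \<theta> = \<phi>)"
    show "\<exists>\<theta>'. (\<theta>' \<in> L (Suc (length (l (Suc k)))) \<and>
        (l (Suc k), tp (l (Suc k) @ [w]) \<theta>' (l (Suc k))) \<in> P \<and>
      (\<forall>c\<in>D. (l (Suc k) @ [c], \<theta>') \<notin> P) \<and> (Suc k = 0 \<longrightarrow> \<theta>' = \<phi>)) \<and>
      tp (l (Suc k) @ [w]) \<theta>' (l k @ [w]) = \<theta>"
    proof (cases "d k \<in> D \<and> d k \<notin> set (l k)")
      case True
      then obtain \<theta>' where "\<theta>' \<in> L (Suc (Suc (length (l k))))"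
        "(l k @ [d k], tp (l k @ [d k, w]) \<theta>' (l k @ [d k])) \<in> P"
        "\<And>c. c \<in> D \<Longrightarrow> (l k @ [d k, c], \<theta>') \<notin> P" "tp (l k @ [d k, w]) \<theta>' (l k @ [w]) = \<theta>"
        using amalg_step[OF coh w, of "l k" "d k" \<theta>] l[of k] \<theta> by metis
      then show ?thesis
        using True by (intro exI[of _ \<theta>']) (simp add: l_Suc)
    next
      case False
      then have "l (Suc k) = l k"
        by (auto simp: l_Suc)
      moreover have "tp (l k @ [w]) \<theta> (l k @ [w]) = \<theta>"
        using \<theta> lw[of k] by (intro tp_self) auto
      ultimately show ?thesis
        using \<theta> by (intro exI[of _ \<theta>]) simp
    qed
  qed
  then obtain \<theta> where \<theta>: "\<And>k. \<theta> k \<in> L (length (l k @ [w]))" "\<And>k. (l k, tp (l k @ [w]) (\<theta> k) (l k)) \<in> P"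
    "\<theta> 0 = \<phi>" "\<And>k. tp (l (Suc k) @ [w]) (\<theta> (Suc k)) (l k @ [w]) = \<theta> k"
    by (auto simp: l_0)
  \<comment> \<open>The type that a tuple receives does not depend on the stage at which it is read
    off; this makes \<open>P'\<close> single-valued.\<close>
  have mono: "tp (l k' @ [w]) (\<theta> k') b = tp (l k @ [w]) (\<theta> k) b"
    if "k \<le> k'" "distinct b" "set b \<subseteq> insert w (set (l k))" for k k' b
    using that(1)
  proof (induction k' rule: dec_induct)
    case (step k')
    have b: "set b \<subseteq> insert w (set (l k'))"
      using that(3) l_mono[OF step.hyps(1)] by blast
    have "tp (l (Suc k') @ [w]) (\<theta> (Suc k')) b =
      tp (l k' @ [w]) (tp (l (Suc k') @ [w]) (\<theta> (Suc k')) (l k' @ [w])) b"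
      by (rule tp_tp[symmetric]) (use \<theta>(1) lw that(2) b l_mono[of k' "Suc k'"] in auto)
    also have "\<dots> = tp (l k' @ [w]) (\<theta> k') b"
      by (simp only: \<theta>(4))
    finally show ?case
      using step.IH by simp
  qed simp
  define P' where "P' = {(b, tp (l k @ [w]) (\<theta> k) b) | k b. distinct b \<and> set b \<subseteq> insert w (set (l k))}"
  have P'I: "(b, tp (l k @ [w]) (\<theta> k) b) \<in> P'" if "distinct b" "set b \<subseteq> insert w (set (l k))" for b k
    using that unfolding P'_def by blast
  have P'E: "\<exists>k. distinct b \<and> set b \<subseteq> insert w (set (l k)) \<and> \<chi> = tp (l k @ [w]) (\<theta> k) b" if
      "(b, \<chi>) \<in> P'" for b \<chi>
    using that unfolding P'_def by blast
  have "P \<subseteq> P'"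
  proof
    fix p assume "p \<in> P"
    then obtain b \<chi> where b: "(b, \<chi>) \<in> P" "p = (b, \<chi>)"
      by (cases p) auto
    obtain k where k: "set b \<subseteq> insert w (set (l k))"
      using cover[of "set b"] coherentD(2)[OF coh b(1)] by auto
    \<comment> \<open>Old tuples avoid \<open>w\<close>, so their types are restrictions of the type
      of \<open>l k\<close>, which the construction never changed.\<close>
    then have k': "set b \<subseteq> set (l k)"
      using coherentD(2)[OF coh b(1)] w by auto
    have "\<chi> = tp (l k) (tp (l k @ [w]) (\<theta> k) (l k)) b"
      using coherent_tp[OF coh \<theta>(2) b(1) k'] .
    also have "\<dots> = tp (l k @ [w]) (\<theta> k) b"
      using \<theta>(1)[of k] lw[of k] l[of k] coherentD(1)[OF coh b(1)] k' by (intro tp_tp) auto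
    finally show "p \<in> P'"
      using P'I[OF coherentD(1)[OF coh b(1)] k] b(2) by simp
  qed
  moreover have "coherent (insert w D) P'"
    unfolding coherent_def
  proof (intro conjI allI impI)
    fix b \<chi> assume "(b, \<chi>) \<in> P'"
    then obtain k where k: "distinct b" "set b \<subseteq> insert w (set (l k))" "\<chi> = tp (l k @ [w]) (\<theta> k) b"
      using P'E by blast
    show "distinct b" "set b \<subseteq> insert w D" "\<chi> \<in> L (length b)"
      using k l[of k] lw[of k] \<theta>(1)[of k] tp_in[of "\<theta> k" "l k @ [w]" b] by auto
  next
    fix b assume b: "distinct b \<and> set b \<subseteq> insert w D"
    then show "\<exists>\<chi>. (b, \<chi>) \<in> P'"
      using cover[of "set b"] P'I by blast
  next
    fix b \<chi> c assume b: "(b, \<chi>) \<in> P' \<and> distinct c \<and> set c \<subseteq> set b"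
    then obtain k where k: "distinct b" "set b \<subseteq> insert w (set (l k))" "\<chi> = tp (l k @ [w]) (\<theta> k) b"
      using P'E by blast
    have "tp b \<chi> c = tp (l k @ [w]) (\<theta> k) c"
      unfolding k(3) using b k(1,2) lw[of k] \<theta>(1)[of k] by (intro tp_tp) auto
    then show "(c, tp b \<chi> c) \<in> P'"
      using P'I[of c k] b k(2) by auto
  next
    show "single_valued P'"
    proof (rule single_valuedI)
      fix b \<chi> \<chi>' assume "(b, \<chi>) \<in> P'" "(b, \<chi>') \<in> P'"
      then obtain k k' where "distinct b" "set b \<subseteq> insert w (set (l k))" "\<chi> = tp (l k @ [w]) (\<theta> k) b"
        "set b \<subseteq> insert w (set (l k'))" "\<chi>' = tp (l k' @ [w]) (\<theta> k') b"
        using P'E by meson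
      then show "\<chi> = \<chi>'"
        using mono[of k k' b] mono[of k' k b] by (cases "k \<le> k'") auto
    qed
  qed
  moreover have "(a @ [w], \<phi>) \<in> P'"
    using P'I[of "a @ [w]" 0] lw[of 0] \<theta>(1,3) tp_self[of \<phi> "a @ [w]"] \<phi> by (simp add: l_0)
  ultimately show thesis
    using that by blast
qed

end

section \<open>Saturated structures of size $\aleph_1$\<close>

abbreviation (input) \<omega>\<^sub>1 :: "nat set rel" where
  "\<omega>\<^sub>1 \<equiv> cardSuc natLeq"

lemma Card_order_\<omega>\<^sub>1: "Card_order \<omega>\<^sub>1"
  by (rule cardSuc_Card_order[OF natLeq_Card_order])

lemma Well_order_\<omega>\<^sub>1: "Well_order \<omega>\<^sub>1"
  by (rule cardSuc_Well_order[OF natLeq_Card_order])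

lemma countable_iff_natLeq: "countable A \<longleftrightarrow> |A| \<le>o natLeq"
proof -
  have "countable A \<longleftrightarrow> |A| \<le>o |UNIV :: nat set|"
    by (auto simp: countable_def card_of_ordLeq[symmetric])
  also have "\<dots> \<longleftrightarrow> |A| \<le>o natLeq"
    using card_of_nat ordIso_symmetric ordLeq_ordIso_trans by blast
  finally show ?thesis .
qed

text \<open>An initial segment below an element of a cardinal is strictly smaller than that
  cardinal, and strictly below a successor cardinal means at most its predecessor.\<close>

lemma countable_underS_\<omega>\<^sub>1: "w \<in> Field \<omega>\<^sub>1 \<Longrightarrow> countable (underS \<omega>\<^sub>1 w)"
  using card_of_underS[OF Card_order_\<omega>\<^sub>1] cardSuc_ordLeq_ordLess[OF natLeq_Card_order card_of_Card_order]
  by (auto simp: countable_iff_natLeq)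

lemma uncountable_Field_\<omega>\<^sub>1: "uncountable (Field \<omega>\<^sub>1)"
proof
  assume "countable (Field \<omega>\<^sub>1)"
  then have "\<omega>\<^sub>1 \<le>o natLeq"
    unfolding countable_iff_natLeq
    by (rule ordIso_ordLeq_trans[OF ordIso_symmetric[OF card_of_Field_ordIso[OF Card_order_\<omega>\<^sub>1]]])
  then show False
    using cardSuc_greater[OF natLeq_Card_order] not_ordLess_ordLeq by blast
qed

lemma underS_total:
  assumes "Well_order r" "x \<in> Field r" "y \<in> Field r" "x \<notin> underS r y"
  shows "y = x \<or> y \<in> underS r x"
proof -
  have "Total r"
    using assms(1) unfolding well_order_on_def linear_order_on_def by simp
  then show ?thesis
    using assms(2-4) by (auto simp: underS_def total_on_def)
qed

lemma card_of_lists_infinite: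
  assumes W: "infinite W"
  shows "|lists W| \<le>o |W|"
proof -
  have "|{xs \<in> lists W. length xs = n}| \<le>o |W|" for n
  proof (induction n)
    case 0
    have "{xs \<in> lists W. length xs = 0} = {[]}"
      by auto
    moreover obtain w where "w \<in> W"
      using W by (metis ex_in_conv finite.emptyI)
    ultimately show ?case
      by (intro card_of_ordLeqI[where f = "\<lambda>_. w"]) auto
  next
    case (Suc n)
    have "{xs \<in> lists W. length xs = Suc n} = (\<lambda>(x, xs). x # xs) ` (W \<times> {xs \<in> lists W. length xs = n})"
      by (auto simp: length_Suc_conv)
    then have "|{xs \<in> lists W. length xs = Suc n}| \<le>o |W \<times> {xs \<in> lists W. length xs = n}|"
      by (simp only: card_of_image)
    also have "|W \<times> {xs \<in> lists W. length xs = n}| \<le>o |W|"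
      using Suc by (intro card_of_Sigma_ordLeq_infinite[OF W] ballI ordLeq_refl card_of_Card_order)
    finally show ?case .
  qed
  moreover have "|UNIV :: nat set| \<le>o |W|"
    using W infinite_iff_card_of_nat by blast
  ultimately have "|\<Union>n. {xs \<in> lists W. length xs = n}| \<le>o |W|"
    by (intro card_of_UNION_ordLeq_infinite[OF W] ballI)
  moreover have "(\<Union>n. {xs \<in> lists W. length xs = n}) = lists W"
    by auto
  ultimately show ?thesis
    by simp
qed

text \<open>The bookkeeping function. Every task recurs uncountably often, so that some occurrence
  comes after any given countable set of steps. This is possible because tasks paired with steps
  still inject into the set of steps.\<close>

lemma ex_uncountable_fibres:
  assumes U: "|U| \<le>o \<omega>\<^sub>1"
  obtains T :: "nat set \<Rightarrow> nat set list \<times> 'p" where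
    "\<And>t. t \<in> lists (Field \<omega>\<^sub>1) \<times> U \<Longrightarrow> uncountable {w \<in> Field \<omega>\<^sub>1. T w = t}"
proof -
  let ?W = "Field \<omega>\<^sub>1"
  have inf: "infinite ?W"
    using uncountable_Field_\<omega>\<^sub>1 uncountable_infinite by blast
  have "|U| \<le>o |?W|"
    using U card_of_Field_ordIso[OF Card_order_\<omega>\<^sub>1] ordIso_symmetric ordLeq_ordIso_trans by blast
  then have "|lists ?W \<times> U| \<le>o |?W|"
    by (intro card_of_Sigma_ordLeq_infinite[OF inf] ballI card_of_lists_infinite[OF inf])
  then have "|(lists ?W \<times> U) \<times> ?W| \<le>o |?W|"
    by (rule card_of_Sigma_ordLeq_infinite[OF inf]) (simp add: card_of_mono1)
  then obtain g where g: "inj_on g ((lists ?W \<times> U) \<times> ?W)" "g ` ((lists ?W \<times> U) \<times> ?W) \<subseteq> ?W"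
    by (auto simp: card_of_ordLeq[symmetric])
  \<comment> \<open>Outside the image of \<open>g\<close> the value is arbitrary; the premises in
    \<open>stage\<close> make such tasks harmless.\<close>
  define T where "T w = fst (the_inv_into ((lists ?W \<times> U) \<times> ?W) g w)" for w
  show thesis
  proof (rule that[of T])
    fix t assume t: "t \<in> lists ?W \<times> U"
    have "T (g (t, x)) = t" if "x \<in> ?W" for x
      using the_inv_into_f_f[OF g(1), of "(t, x)"] t that by (simp add: T_def)
    moreover have "g (t, x) \<in> ?W" if "x \<in> ?W" for x
      using g(2) t that by blast
    ultimately have "(\<lambda>x. g (t, x)) ` ?W \<subseteq> {w \<in> ?W. T w = t}"
      by blast
    moreover have "inj_on (\<lambda>x. g (t, x)) ?W"
    proof (rule inj_onI)
      fix x y assume "x \<in> ?W" "y \<in> ?W" "g (t, x) = g (t, y)"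
      then show "x = y"
        using inj_onD[OF g(1), of "(t, x)" "(t, y)"] t by simp
    qed
    then have "uncountable ((\<lambda>x. g (t, x)) ` ?W)"
      using uncountable_Field_\<omega>\<^sub>1 countable_image_inj_on by blast
    ultimately show "uncountable {w \<in> ?W. T w = t}"
      using countable_subset by blast
  qed
qed

section \<open>The construction of length \<omega>_1\<close>

context type_system
begin

text \<open>A stage \<open>(I, D, P)\<close> consists of the initial segment \<open>I\<close> of \<open>\<omega>\<^sub>1\<close> of steps already
  performed, the set \<open>D\<close> of those steps that created a new element, and the types of the tuples
  over \<open>D\<close>. The step \<open>w\<close> realizes \<open>\<phi>\<close> over \<open>a\<close>, where \<open>T w = (a, \<phi>)\<close>.\<close>

definition stage :: "(nat set \<Rightarrow> nat set list \<times> 'p) \<Rightarrow>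
    nat set set \<times> nat set set \<times> (nat set list \<times> 'p) set \<Rightarrow> bool" where
  "stage T = (\<lambda>(I, D, P). I \<subseteq> Field \<omega>\<^sub>1 \<and> (\<forall>w\<in>I. underS \<omega>\<^sub>1 w \<subseteq> I) \<and> D \<subseteq> I \<and> coherent D P \<and>
    (\<forall>w\<in>I. \<forall>a \<phi>. T w = (a, \<phi>) \<and> set a \<subseteq> underS \<omega>\<^sub>1 w \<and> \<phi> \<in> L (Suc (length a)) \<and>
      (a, H (Suc (length a)) (length a) \<phi> id) \<in> P \<longrightarrow> (\<exists>c\<in>D. (a @ [c], \<phi>) \<in> P)))"

definition stage_le :: "'a set \<times> 'b set \<times> 'c set \<Rightarrow> 'a set \<times> 'b set \<times> 'c set \<Rightarrow> bool" where
  "stage_le = (\<lambda>(I, D, P) (I', D', P'). I \<subseteq> I' \<and> D \<subseteq> D' \<and> P \<subseteq> P')"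

lemma stageI:
  assumes "I \<subseteq> Field \<omega>\<^sub>1" "\<And>w. w \<in> I \<Longrightarrow> underS \<omega>\<^sub>1 w \<subseteq> I" "D \<subseteq> I" "coherent D P"
    "\<And>w a \<phi>. w \<in> I \<Longrightarrow> T w = (a, \<phi>) \<Longrightarrow> set a \<subseteq> underS \<omega>\<^sub>1 w \<Longrightarrow> \<phi> \<in> L (Suc (length a)) \<Longrightarrow>
      (a, H (Suc (length a)) (length a) \<phi> id) \<in> P \<Longrightarrow> \<exists>c\<in>D. (a @ [c], \<phi>) \<in> P"
  shows "stage T (I, D, P)"
  using assms unfolding stage_def by blast

lemma stageD:
  assumes "stage T (I, D, P)"
  shows "I \<subseteq> Field \<omega>\<^sub>1" "w \<in> I \<Longrightarrow> underS \<omega>\<^sub>1 w \<subseteq> I" "D \<subseteq> I" "coherent D P"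
    "w \<in> I \<Longrightarrow> T w = (a, \<phi>) \<Longrightarrow> set a \<subseteq> underS \<omega>\<^sub>1 w \<Longrightarrow> \<phi> \<in> L (Suc (length a)) \<Longrightarrow>
      (a, H (Suc (length a)) (length a) \<phi> id) \<in> P \<Longrightarrow> \<exists>c\<in>D. (a @ [c], \<phi>) \<in> P"
  using assms unfolding stage_def by blast+

lemma coherent_trivial: "\<exists>P. coherent {} P"
proof -
  obtain \<phi> where \<phi>: "L 0 = {\<phi>}"
    using L_0 by blast
  then have "tp [] \<phi> [] = \<phi>"
    using tp_self[of \<phi> "[]"] by simp
  then have "coherent {} {([], \<phi>)}"
    using \<phi> by (auto simp: coherent_def single_valued_def)
  then show ?thesis ..
qed

text \<open>Coherence is of finite character: a tuple has finitely many entries, and finitely many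
  facts about a chain all hold in one of its members.\<close>

lemma stage_Union:
  assumes C: "\<And>s. s \<in> C \<Longrightarrow> stage T s" "\<And>s s'. s \<in> C \<Longrightarrow> s' \<in> C \<Longrightarrow> stage_le s s' \<or> stage_le s' s"
    and ne: "C \<noteq> {}"
  shows "stage T (\<Union>(fst ` C), \<Union>((fst \<circ> snd) ` C), \<Union>((snd \<circ> snd) ` C))"
proof -
  let ?I = "\<Union>(fst ` C)" and ?D = "\<Union>((fst \<circ> snd) ` C)" and ?P = "\<Union>((snd \<circ> snd) ` C)"
  have st: "stage T (I, D, P) \<and> I \<subseteq> ?I \<and> D \<subseteq> ?D \<and> P \<subseteq> ?P" if "(I, D, P) \<in> C" for I D P
    using that C(1) by force
  have ex_I: "\<exists>I D P. (I, D, P) \<in> C \<and> w \<in> I" if "w \<in> ?I" for w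
    using that by force
  have ex_P: "\<exists>I D P. (I, D, P) \<in> C \<and> p \<in> P" if "p \<in> ?P" for p
    using that by force
  have dir: "\<exists>I'' D'' P''. (I'', D'', P'') \<in> C \<and> I \<subseteq> I'' \<and> I' \<subseteq> I'' \<and> D \<subseteq> D'' \<and> D' \<subseteq> D'' \<and> P \<subseteq> P'' \<and>
      P' \<subseteq> P''"
    if "(I, D, P) \<in> C" "(I', D', P') \<in> C" for I D P I' D' P'
    using C(2)[OF that] that unfolding stage_le_def by (auto; blast)
  have fin: "\<exists>I D P. (I, D, P) \<in> C \<and> B \<subseteq> D" if "finite B" "B \<subseteq> ?D" for B
    using that
  proof (induction B rule: finite_induct)
    case empty
    then show ?case using ne by auto
  next
    case (insert x B)
    then obtain I D P where 1: "(I, D, P) \<in> C" "B \<subseteq> D"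
      by auto
    obtain I' D' P' where 2: "(I', D', P') \<in> C" "x \<in> D'"
      using insert.prems by force
    show ?case
      using dir[OF 1(1) 2(1)] 1(2) 2(2) by blast
  qed
  have coh: "coherent ?D ?P"
    unfolding coherent_def
  proof (intro conjI allI impI)
    fix a \<phi> assume "(a, \<phi>) \<in> ?P"
    then obtain I D P where "(I, D, P) \<in> C" "(a, \<phi>) \<in> P"
      using ex_P by blast
    then show "distinct a" "set a \<subseteq> ?D" "\<phi> \<in> L (length a)"
      using st coherentD(1-3)[OF stageD(4)] by (meson order_trans)+
  next
    fix a assume a: "distinct a \<and> set a \<subseteq> ?D"
    then obtain I D P where "(I, D, P) \<in> C" "set a \<subseteq> D"
      using fin[of "set a"] by blast
    then show "\<exists>\<phi>. (a, \<phi>) \<in> ?P"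
      using a st coherentD(4)[OF stageD(4)] by (meson subsetD)
  next
    fix a \<phi> b assume a: "(a, \<phi>) \<in> ?P \<and> distinct b \<and> set b \<subseteq> set a"
    then obtain I D P where "(I, D, P) \<in> C" "(a, \<phi>) \<in> P"
      using ex_P by blast
    then show "(b, tp a \<phi> b) \<in> ?P"
      using a st coherentD(5)[OF stageD(4)] by (meson subsetD)
  next
    show "single_valued ?P"
    proof (rule single_valuedI)
      fix a \<phi> \<psi> assume "(a, \<phi>) \<in> ?P" "(a, \<psi>) \<in> ?P"
      then obtain I D P I' D' P' where "(I, D, P) \<in> C" "(a, \<phi>) \<in> P" "(I', D', P') \<in> C" "(a, \<psi>) \<in> P'"
        using ex_P by meson
      then obtain I'' D'' P'' where "(I'', D'', P'') \<in> C" "(a, \<phi>) \<in> P''" "(a, \<psi>) \<in> P''"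
        using dir by (meson subsetD)
      then show "\<phi> = \<psi>"
        using st coherentD(6)[OF stageD(4)] by blast
    qed
  qed
  show ?thesis
  proof (rule stageI[OF _ _ _ coh])
    show "?I \<subseteq> Field \<omega>\<^sub>1"
    proof
      fix w assume "w \<in> ?I"
      then obtain I D P where "(I, D, P) \<in> C" "w \<in> I"
        using ex_I by blast
      then show "w \<in> Field \<omega>\<^sub>1"
        using stageD(1)[of T I D P] st by blast
    qed
    show "underS \<omega>\<^sub>1 w \<subseteq> ?I" if w: "w \<in> ?I" for w
    proof -
      obtain I D P where "(I, D, P) \<in> C" "w \<in> I"
        using ex_I[OF w] by blast
      then show ?thesis
        using stageD(2)[of T I D P w] st[of I D P] by blast
    qed
    show "?D \<subseteq> ?I"
    proof
      fix w assume "w \<in> ?D"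
      then obtain I D P where "(I, D, P) \<in> C" "w \<in> D"
        by force
      then show "w \<in> ?I"
        using stageD(3)[of T I D P] st[of I D P] by blast
    qed
    fix w a \<phi>
    assume w: "w \<in> ?I" and t: "T w = (a, \<phi>)" "set a \<subseteq> underS \<omega>\<^sub>1 w" "\<phi> \<in> L (Suc (length a))"
      and P: "(a, H (Suc (length a)) (length a) \<phi> id) \<in> ?P"
    \<comment> \<open>The step \<open>w\<close> and the type of \<open>a\<close> may come from
      different members of the chain; the larger of the two contains both and supplies the
      witness.\<close>
    obtain I D P I' D' P' where "(I, D, P) \<in> C" "w \<in> I" "(I', D', P') \<in> C"
      "(a, H (Suc (length a)) (length a) \<phi> id) \<in> P'"
      using ex_I[OF w] ex_P[OF P] by (elim exE conjE) (rule that)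
    then obtain I'' D'' P'' where s: "(I'', D'', P'') \<in> C" "w \<in> I''"
      "(a, H (Suc (length a)) (length a) \<phi> id) \<in> P''"
      using dir by (meson subsetD)
    then have "\<exists>c\<in>D''. (a @ [c], \<phi>) \<in> P''"
      using stageD(5)[OF conjunct1[OF st[OF s(1)]] s(2) t s(3)] by simp
    then show "\<exists>c\<in>?D. (a @ [c], \<phi>) \<in> ?P"
      using st[OF s(1)] by blast
  qed
qed

text \<open>The steps performed are exactly the predecessors of the least missing step
  \<open>w\<close>, so there are countably many, and \<open>D\<close> is countable too. The step
  \<open>w\<close> itself is the candidate for the new point; it is fresh because
  \<open>D \<subseteq> I\<close>.\<close>

lemma stage_extend:
  assumes s: "stage T (I, D, P)" and ne: "I \<noteq> Field \<omega>\<^sub>1"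
  obtains s' where "stage T s'" "stage_le (I, D, P) s'" "s' \<noteq> (I, D, P)"
proof -
  have "wf (\<omega>\<^sub>1 - Id)"
    using Well_order_\<omega>\<^sub>1 by (simp add: well_order_on_def)
  moreover obtain x where "x \<in> Field \<omega>\<^sub>1 - I"
    using ne stageD(1)[OF s] by blast
  ultimately obtain w where w: "w \<in> Field \<omega>\<^sub>1 - I" and min: "\<And>y. (y, w) \<in> \<omega>\<^sub>1 - Id \<Longrightarrow> y \<notin> Field \<omega>\<^sub>1 - I"
    by (rule wfE_min) blast
  have "underS \<omega>\<^sub>1 w \<subseteq> I"
    using min unfolding underS_def by (auto simp: Field_def)
  moreover have "I \<subseteq> underS \<omega>\<^sub>1 w"
  proof
    fix x assume x: "x \<in> I"
    show "x \<in> underS \<omega>\<^sub>1 w"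
      using underS_total[OF Well_order_\<omega>\<^sub>1, of x w] x w stageD(1,2)[OF s] by blast
  qed
  ultimately have I: "I = underS \<omega>\<^sub>1 w"
    by blast
  have "countable I"
    using countable_underS_\<omega>\<^sub>1 w I by auto
  then have D: "countable D" "w \<notin> D"
    using stageD(3)[OF s] w countable_subset by auto
  note coh = stageD(4)[OF s]
  have stage_insert: "stage T (insert w I, D', P')"
    if D': "D \<subseteq> D'" "D' \<subseteq> insert w D" and P': "P \<subseteq> P'" "coherent D' P'"
      and new: "\<And>a \<phi>. T w = (a, \<phi>) \<Longrightarrow> \<phi> \<in> L (Suc (length a)) \<Longrightarrow>
        (a, H (Suc (length a)) (length a) \<phi> id) \<in> P \<Longrightarrow> \<exists>c\<in>D'. (a @ [c], \<phi>) \<in> P'"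
    for D' P'
  proof (rule stageI[OF _ _ _ P'(2)])
    show "insert w I \<subseteq> Field \<omega>\<^sub>1"
      using w stageD(1)[OF s] by blast
    show "underS \<omega>\<^sub>1 x \<subseteq> insert w I" if "x \<in> insert w I" for x
      using that stageD(2)[OF s] I by blast
    show "D' \<subseteq> insert w I"
      using D'(2) stageD(3)[OF s] by blast
    fix x a \<phi>
    assume x: "x \<in> insert w I" and t: "T x = (a, \<phi>)" "set a \<subseteq> underS \<omega>\<^sub>1 x" "\<phi> \<in> L (Suc (length a))"
      and P: "(a, H (Suc (length a)) (length a) \<phi> id) \<in> P'"
    \<comment> \<open>A task is binding only for tuples created before its step. Hence
      \<open>a\<close> cannot contain \<open>w\<close>, its type was already decided in
      \<open>P\<close>, and the new point creates no further obligation for the steps performed so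
      far.\<close>
    have "set a \<subseteq> I"
      using x t(2) I stageD(2)[OF s] by blast
    then have a: "distinct a" "set a \<subseteq> D"
      using coherentD(1,2)[OF P'(2) P] D'(2) w by blast+
    then obtain \<psi> where "(a, \<psi>) \<in> P"
      using coherentD(4)[OF coh] by blast
    then have P0: "(a, H (Suc (length a)) (length a) \<phi> id) \<in> P"
      using P P'(1) coherentD(6)[OF P'(2)] by (metis subsetD)
    show "\<exists>c\<in>D'. (a @ [c], \<phi>) \<in> P'"
    proof (cases "x = w")
      case True
      then show ?thesis using new t P0 by blast
    next
      case False
      then have "x \<in> I"
        using x by simp
      then show ?thesis
        using stageD(5)[OF s _ t P0] D'(1) P'(1) by blast
    qed
  qed
  obtain a \<phi> where T: "T w = (a, \<phi>)"
    by (cases "T w")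
  show thesis
  proof (cases "\<phi> \<in> L (Suc (length a)) \<and> (a, H (Suc (length a)) (length a) \<phi> id) \<in> P \<and>
      (\<forall>c\<in>D. (a @ [c], \<phi>) \<notin> P)")
    case True
    then obtain P' where P': "P \<subseteq> P'" "coherent (insert w D) P'" "(a @ [w], \<phi>) \<in> P'"
      using one_point_extension[OF coh D] by metis
    then have "stage T (insert w I, insert w D, P')"
      using T by (intro stage_insert) auto
    then show thesis
      by (rule that) (use P'(1) w in \<open>auto simp: stage_le_def\<close>)
  next
    case False
    \<comment> \<open>A task that is void or already fulfilled adds no point, but its step is
      recorded, so the stage still grows properly.\<close>
    then have "stage T (insert w I, D, P)"
      using T coh by (intro stage_insert) auto
    then show thesis
      by (rule that) (use w in \<open>auto simp: stage_le_def\<close>)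
  qed
qed

text \<open>A maximal stage has performed every step of \<omega>_1. Each task over a tuple from
  \<open>D\<close> is listed at some step after all the entries of that tuple, where the stage
  condition provides a realization.\<close>

theorem ex_saturated:
  obtains D :: "nat set set" and P where "coherent D P"
    "\<And>a \<phi>. \<phi> \<in> L (Suc (length a)) \<Longrightarrow> (a, H (Suc (length a)) (length a) \<phi> id) \<in> P \<Longrightarrow> \<exists>c\<in>D. (a @ [c], \<phi>) \<in> P"
proof -
  obtain T where T: "\<And>t. t \<in> lists (Field \<omega>\<^sub>1) \<times> (\<Union>n. L n) \<Longrightarrow> uncountable {w \<in> Field \<omega>\<^sub>1. T w = t}"
    by (rule ex_uncountable_fibres[OF card_L]) (rule that)
  have "\<exists>m\<in>Collect (stage T). \<forall>s\<in>Collect (stage T). stage_le m s \<longrightarrow> s = m"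
  proof (rule predicate_Zorn)
    show "partial_order_on (Collect (stage T)) (relation_of stage_le (Collect (stage T)))"
      by (rule partial_order_on_relation_ofI) (auto simp: stage_le_def)
    fix C assume C: "C \<in> Chains (relation_of stage_le (Collect (stage T)))"
    show "\<exists>u\<in>Collect (stage T). \<forall>s\<in>C. stage_le s u"
    proof (cases "C = {}")
      case True
      obtain P :: "(nat set list \<times> 'p) set" where "coherent {} P"
        using coherent_trivial by blast
      then have "stage T ({}, {}, P)"
        by (intro stageI) auto
      then show ?thesis
        using True by auto
    next
      case False
      have "stage T (\<Union>(fst ` C), \<Union>((fst \<circ> snd) ` C), \<Union>((snd \<circ> snd) ` C))"
        by (rule stage_Union) (use C False in \<open>auto simp: Chains_def relation_of_def\<close>)
      moreover have "\<forall>s\<in>C. stage_le s (\<Union>(fst ` C), \<Union>((fst \<circ> snd) ` C), \<Union>((snd \<circ> snd) ` C))"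
        by (force simp: stage_le_def)
      ultimately show ?thesis
        by blast
    qed
  qed
  then obtain m where m: "stage T m" "\<And>s. stage T s \<Longrightarrow> stage_le m s \<Longrightarrow> s = m"
    by blast
  obtain I D P where "m = (I, D, P)"
    by (cases m)
  note s = m(1)[unfolded this] and max = m(2)[unfolded this]
  have I: "I = Field \<omega>\<^sub>1"
    by (rule ccontr) (use stage_extend[OF s] max in blast)
  have "\<exists>c\<in>D. (a @ [c], \<phi>) \<in> P" if \<phi>: "\<phi> \<in> L (Suc (length a))" and a:
      "(a, H (Suc (length a)) (length a) \<phi> id) \<in> P" for a \<phi>
  proof -
    let ?F = "{w \<in> Field \<omega>\<^sub>1. T w = (a, \<phi>)}"
    have aI: "set a \<subseteq> Field \<omega>\<^sub>1"
      using coherentD(2)[OF stageD(4)[OF s] a] stageD(3)[OF s] I by blast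
    then have "(a, \<phi>) \<in> lists (Field \<omega>\<^sub>1) \<times> (\<Union>n. L n)"
      using \<phi> by auto
    then have "uncountable ?F"
      by (rule T)
    \<comment> \<open>These are the steps that fail to come after every entry of
      \<open>a\<close>.\<close>
    moreover have "countable (\<Union>x\<in>set a. insert x (underS \<omega>\<^sub>1 x))"
    proof (rule countable_UN)
      show "countable (set a)"
        by (simp add: countable_finite)
      show "countable (insert x (underS \<omega>\<^sub>1 x))" if "x \<in> set a" for x
        using that aI countable_underS_\<omega>\<^sub>1[of x] by auto
    qed
    ultimately have "\<not> ?F \<subseteq> (\<Union>x\<in>set a. insert x (underS \<omega>\<^sub>1 x))"
      by (metis countable_subset)
    then obtain w where w: "w \<in> Field \<omega>\<^sub>1" "T w = (a, \<phi>)" "w \<notin> (\<Union>x\<in>set a. insert x (underS \<omega>\<^sub>1 x))"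
      by auto
    have "x \<in> underS \<omega>\<^sub>1 w" if "x \<in> set a" for x
      using that w(1,3) aI underS_total[OF Well_order_\<omega>\<^sub>1, of x w] by auto
    then have "set a \<subseteq> underS \<omega>\<^sub>1 w"
      by blast
    then show ?thesis
      using stageD(5)[OF s _ w(2) _ \<phi> a] w(1) I by simp
  qed
  then show thesis
    using that stageD(4)[OF s] by blast
qed

end

section \<open>The structure determined by a saturated assignment\<close>

lemma injs_extend:
  assumes j: "j \<in> injs m n"
  obtains \<pi> where "\<pi> \<in> injs n n" "\<And>i. i < m \<Longrightarrow> \<pi> i = j i"
proof -
  have inj: "inj_on j {..<m}" and im: "j ` {..<m} \<subseteq> {..<n}" and mn: "m \<le> n"
    using j injs_le by (auto simp: injs_def)
  have "card {m..<n} = card ({..<n} - j ` {..<m})"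
    using im inj by (simp add: card_Diff_subset card_image)
  then obtain g where g: "bij_betw g {m..<n} ({..<n} - j ` {..<m})"
    by (metis finite_Diff finite_atLeastLessThan finite_lessThan finite_same_card_bij)
  define \<pi> where "\<pi> i = (if i < m then j i else g i)" for i
  have "\<pi> i \<in> {..<n}" if "i < n" for i
    using that im bij_betwE[OF g] by (auto simp: \<pi>_def)
  moreover have "i = i'" if i: "i < n" "i' < n" "\<pi> i = \<pi> i'" for i i'
  proof -
    have out: "g k \<notin> j ` {..<m}" if "k < n" "\<not> k < m" for k
      using bij_betwE[OF g] that by auto
    consider "i < m" "i' < m" | "i < m" "\<not> i' < m" | "\<not> i < m" "i' < m" | "\<not> i < m" "\<not> i' < m"
      by blast
    then show ?thesis
    proof cases
      case 1
      then show ?thesis using i inj by (auto simp: \<pi>_def dest: inj_onD)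
    next
      case 2
      then show ?thesis using i out[of i'] by (metis \<pi>_def image_eqI lessThan_iff)
    next
      case 3
      then show ?thesis using i out[of i] by (metis \<pi>_def image_eqI lessThan_iff)
    next
      case 4
      then show ?thesis using i bij_betw_imp_inj_on[OF g] by (auto simp: \<pi>_def dest: inj_onD)
    qed
  qed
  ultimately have "\<pi> \<in> injs n n"
    by (auto simp: injs_def inj_on_def)
  then show thesis
    using that by (simp add: \<pi>_def)
qed

lemma tuple_fm_succ:
  "succ_of \<beta> \<alpha> \<Longrightarrow> tuple_fm ar M a \<alpha> = succ_fm (length a) (tuple_fm ar M a \<beta>)
         ((\<lambda>c. tuple_fm ar M (a @ [c]) \<beta>) ` (univ M - set a))"
  by (subst tuple_fm.simps) (simp add: succ_of_not pred_ord_eq)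

lemma tuple_fm_limit:
  "limit_ord \<alpha> \<Longrightarrow> tuple_fm ar M a \<alpha> = BigAnd ((\<lambda>\<beta>. tuple_fm ar M a \<beta>) ` {..<\<alpha>})"
  by (subst tuple_fm.simps) (simp add: limit_not_zero)

locale amalgamating_process =
  fixes ar :: "'r \<Rightarrow> nat"
    and \<delta> :: "'o::wellorder"
    and \<Phi> :: "'o \<Rightarrow> ('r, 'o, 'k) fml set"
  assumes process: "scott_process ar {..\<delta>} \<Phi>"
    and nonempty: "\<Phi> \<delta> \<noteq> {}"
    and amalg: "amalgamates ar \<delta> (\<Phi> \<delta>)"
    and card: "|\<Phi> \<delta>| \<le>o cardSuc natLeq"
begin

text \<open>Each of these is the conjunction of all clauses from the one named on, in the numbering of the paper.\<close>

lemmas process_1a = process[unfolded scott_process_def, THEN conjunct2]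
lemmas process_1c = process_1a[THEN conjunct2, THEN conjunct2]
lemmas process_1d = process_1c[THEN conjunct2]
lemmas process_1e = process_1d[THEN conjunct2]
lemmas process_2a = process_1e[THEN conjunct2]
lemmas process_2b = process_2a[THEN conjunct2]
lemmas process_2c = process_2b[THEN conjunct2]

section \<open>The top level as a type system\<close>

lemma Phi_subset: "\<Phi> \<delta> \<subseteq> (\<Union>n. Psi ar \<delta> n)"
  using process_1a[THEN conjunct1, rule_format, of \<delta>] by simp

lemma Phi_eq_vproj: "\<alpha> \<le> \<delta> \<Longrightarrow> \<Phi> \<alpha> = vproj ar \<alpha> \<delta> ` \<Phi> \<delta>"
  using process_1c[THEN conjunct1, rule_format, of _ \<delta>] by (cases "\<alpha> = \<delta>") auto

lemma hproj_perm: "\<phi> \<in> level ar \<Phi> \<delta> n \<Longrightarrow> j \<in> injs n n \<Longrightarrow> hproj ar \<delta> n n \<phi> j \<in> level ar \<Phi> \<delta> n"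
  using process_1d[THEN conjunct1, rule_format, of \<delta>] by simp

lemma level_hproj: "m < n \<Longrightarrow> level ar \<Phi> \<delta> m = (\<lambda>\<phi>. hproj ar \<delta> n m \<phi> id) ` level ar \<Phi> \<delta> n"
  using process_1e[THEN conjunct1, rule_format, of \<delta>] by blast

lemma exts_eq:
  "succ_of \<alpha> \<beta> \<Longrightarrow> \<beta> \<le> \<delta> \<Longrightarrow> \<phi> \<in> level ar \<Phi> \<beta> n \<Longrightarrow>
    exts \<phi> = vproj ar \<alpha> \<beta> ` {\<psi> \<in> level ar \<Phi> \<beta> (Suc n). hproj ar \<beta> (Suc n) n \<psi> id = \<phi>}"
  using process_2a[THEN conjunct1, rule_format, of \<alpha> \<beta>] by blast

lemma exts_vproj_subset:
  "succ_of \<alpha> \<alpha>' \<Longrightarrow> \<alpha> < \<delta> \<Longrightarrow> \<phi> \<in> level ar \<Phi> \<delta> n \<Longrightarrow>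
    exts (vproj ar \<alpha>' \<delta> \<phi>) \<subseteq> vproj ar \<alpha> \<delta> ` {\<psi> \<in> level ar \<Phi> \<delta> (Suc n). hproj ar \<delta> (Suc n) n \<psi> id = \<phi>}"
  using process_2b[THEN conjunct1, rule_format, of \<alpha> \<alpha>' \<delta>] by blast

lemma joint_embedding:
  "\<phi> \<in> level ar \<Phi> \<delta> n \<Longrightarrow> \<psi> \<in> level ar \<Phi> \<delta> m \<Longrightarrow> \<exists>\<theta>\<in>level ar \<Phi> \<delta> (n + m). \<exists>j\<in>injs m (n + m).
         \<phi> = hproj ar \<delta> (n + m) n \<theta> id \<and> \<psi> = hproj ar \<delta> (n + m) m \<theta> j"
  using process_2c[rule_format, of \<delta>] by blast

lemma level_Psi: "\<phi> \<in> level ar \<Phi> \<delta> n \<Longrightarrow> \<phi> \<in> Psi ar \<delta> n"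
  by (simp add: level_def)

text \<open>Closure is postulated for permutations and for inclusions only. An arbitrary injection
  is the inclusion followed by a permutation extending it, and \<open>hproj_hproj\<close> composes
  the two projections.\<close>

lemma hproj_in_level:
  assumes \<phi>: "\<phi> \<in> level ar \<Phi> \<delta> n" and j: "j \<in> injs m n"
  shows "hproj ar \<delta> n m \<phi> j \<in> level ar \<Phi> \<delta> m"
proof -
  obtain \<pi> where \<pi>: "\<pi> \<in> injs n n" "\<And>i. i < m \<Longrightarrow> \<pi> i = j i"
    using injs_extend[OF j] by metis
  have mn: "m \<le> n"
    using injs_le[OF j] .
  have "hproj ar \<delta> n m \<phi> j = hproj ar \<delta> n m \<phi> (\<pi> \<circ> id)"
    by (rule hproj_cong) (simp add: \<pi>(2))
  also have "\<dots> = hproj ar \<delta> n m (hproj ar \<delta> n n \<phi> \<pi>) id"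
    by (rule hproj_hproj[OF level_Psi[OF \<phi>] \<pi>(1) injs_id[OF mn], symmetric])
  also have "\<dots> \<in> level ar \<Phi> \<delta> m"
  proof (cases "m = n")
    case True
    then show ?thesis
      using hproj_perm[OF \<phi> \<pi>(1)] hproj_id[OF level_Psi] by metis
  next
    case False
    then show ?thesis
      using hproj_perm[OF \<phi> \<pi>(1)] level_hproj[of m n] mn by auto
  qed
  finally show ?thesis .
qed

text \<open>All injections from the empty set of variables agree, so joint embedding of two types of
  the empty tuple makes them equal. Existence comes from projecting any formula of the
  level.\<close>

lemma level_0_singleton: "\<exists>\<phi>. level ar \<Phi> \<delta> 0 = {\<phi>}"
proof -
  obtain \<phi> n where "\<phi> \<in> level ar \<Phi> \<delta> n"
    using nonempty Phi_subset by (fastforce simp: level_def)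
  then have "hproj ar \<delta> n 0 \<phi> id \<in> level ar \<Phi> \<delta> 0"
    by (intro hproj_in_level injs_id) auto
  moreover have "\<phi> = \<psi>" if \<phi>\<psi>: "\<phi> \<in> level ar \<Phi> \<delta> 0" "\<psi> \<in> level ar \<Phi> \<delta> 0" for \<phi> \<psi>
  proof -
    obtain \<theta> j where \<theta>: "\<phi> = hproj ar \<delta> 0 0 \<theta> id" "\<psi> = hproj ar \<delta> 0 0 \<theta> j"
      using joint_embedding[OF \<phi>\<psi>] by auto
    have "hproj ar \<delta> 0 0 \<theta> id = hproj ar \<delta> 0 0 \<theta> j"
      by (rule hproj_cong) simp
    then show ?thesis
      using \<theta> by simp
  qed
  ultimately show ?thesis
    by blast
qed

sublocale type_system "level ar \<Phi> \<delta>" "hproj ar \<delta>"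
proof
  show "hproj ar \<delta> n m \<phi> j \<in> level ar \<Phi> \<delta> m" if "\<phi> \<in> level ar \<Phi> \<delta> n" "j \<in> injs m n" for \<phi> n j m
    using that by (rule hproj_in_level)
  show "hproj ar \<delta> n m \<phi> j = hproj ar \<delta> n m \<phi> k" if "\<And>i. i < m \<Longrightarrow> j i = k i" for m j k n and \<phi> ::
      "('r, 'o, 'k) fml"
    using that by (rule hproj_cong)
  show "hproj ar \<delta> m l (hproj ar \<delta> n m \<phi> j) k = hproj ar \<delta> n l \<phi> (j \<circ> k)"
    if "\<phi> \<in> level ar \<Phi> \<delta> n" "j \<in> injs m n" "k \<in> injs l m" for \<phi> n j m k l
    using that by (intro hproj_hproj level_Psi)
  show "hproj ar \<delta> n n \<phi> id = \<phi>" if "\<phi> \<in> level ar \<Phi> \<delta> n" for \<phi> n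
    using that by (intro hproj_id level_Psi)
  show "\<exists>\<phi>. level ar \<Phi> \<delta> 0 = {\<phi>}"
    by (rule level_0_singleton)
  show "\<phi> = \<psi> \<or> (\<exists>\<theta>\<in>level ar \<Phi> \<delta> (Suc (Suc n)). hproj ar \<delta> (Suc (Suc n)) (Suc n) \<theta> (id(n := Suc n)) = \<phi> \<and>
      hproj ar \<delta> (Suc (Suc n)) (Suc n) \<theta> id = \<psi>)"
    if \<phi>\<psi>: "\<phi> \<in> level ar \<Phi> \<delta> (Suc n)" "\<psi> \<in> level ar \<Phi> \<delta> (Suc n)"
      "hproj ar \<delta> (Suc n) n \<phi> id = hproj ar \<delta> (Suc n) n \<psi> id" for \<phi> n \<psi>
  proof -
    obtain \<theta> y where \<theta>: "\<theta> \<in> level ar \<Phi> \<delta> (Suc (Suc n))" "y \<in> {..<Suc (Suc n)} - {..<n}"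
      "hproj ar \<delta> (Suc (Suc n)) (Suc n) \<theta> (id(n := y)) = \<phi>" "hproj ar \<delta> (Suc (Suc n)) (Suc n) \<theta> id = \<psi>"
      using amalg[unfolded amalgamates_def, rule_format, of n "Suc n" \<phi> \<psi>] \<phi>\<psi>
      unfolding level_def by blast
    \<comment> \<open>With y = n both restrictions of \<theta> are along the inclusion, which forces
      \<phi> = \<psi>.\<close>
    have "y = n \<or> y = Suc n"
      using \<theta>(2) by auto
    then show ?thesis
    proof
      assume "y = n"
      then have "id(n := y) = id"
        by auto
      then have "\<phi> = \<psi>"
        using \<theta>(3,4) by (simp only:)
      then show ?thesis ..
    qed (use \<theta> in blast)
  qed
  have "(\<Union>n. level ar \<Phi> \<delta> n) \<subseteq> \<Phi> \<delta>"
    by (auto simp: level_def)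
  then show "|\<Union>n. level ar \<Phi> \<delta> n| \<le>o cardSuc natLeq"
    by (rule ordLeq_transitive[OF card_of_mono1 card])
qed

text \<open>Whether \<open>R\<close> holds of \<open>as\<close> is read off the type of the tuple \<open>remdups as\<close>
  of the distinct entries of \<open>as\<close>.\<close>

definition model :: "nat set set \<Rightarrow> (nat set list \<times> ('r, 'o, 'k) fml) set \<Rightarrow> ('r, nat set) struct" where
  "model D P = \<lparr>univ = D, interp = (\<lambda>R. {as. length as = ar R \<and> set as \<subseteq> D \<and>
     (\<exists>\<phi> vs \<zeta>. zero_ord (\<zeta> :: 'o) \<and> (remdups as, \<phi>) \<in> P \<and> set vs \<subseteq> {..<length (remdups as)} \<and>
        as = map ((!) (remdups as)) vs \<and> Rel R vs \<in> conjuncts (vproj ar \<zeta> \<delta> \<phi>))})\<rparr>"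

text \<open>The truth value of an atom does not depend on the tuple from which it is read:
  restriction commutes with projection to level zero, where it is a renaming.\<close>

lemma atom_transfer:
  assumes coh: "coherent D P" and a: "(a, \<phi>) \<in> P" and b: "(b, \<psi>) \<in> P" "set b \<subseteq> set a"
    and z: "zero_ord \<zeta>" and vs: "set vs \<subseteq> {..<length b}" "length vs = ar R"
  shows "Rel R vs \<in> conjuncts (vproj ar \<zeta> \<delta> \<psi>) \<longleftrightarrow>
    Rel R (map (pos a) (map ((!) b) vs)) \<in> conjuncts (vproj ar \<zeta> \<delta> \<phi>)"
proof -
  let ?j = "\<lambda>i. pos a (b ! i)"
  have d: "distinct a" "distinct b"
    using coherentD(1)[OF coh] a b by blast+
  have \<phi>: "\<phi> \<in> Psi ar \<delta> (length a)"
    using coherentD(3)[OF coh a] level_Psi by blast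
  have j: "?j \<in> injs (length b) (length a)"
    using injs_pos d b(2) by blast
  have "vproj ar \<zeta> \<delta> \<phi> \<in> Psi ar \<zeta> (length a)"
    using vproj_in_Psi[OF zero_ord_le[OF z] \<phi>] .
  then obtain Q where Q: "vproj ar \<zeta> \<delta> \<phi> = base_fm ar (length a) Q"
    by (rule Psi_zeroE[OF z])
  have "\<psi> = hproj ar \<delta> (length a) (length b) \<phi> ?j"
    using coherent_tp[OF coh a b] by (simp only: tp_def)
  then have "vproj ar \<zeta> \<delta> \<psi> = hproj ar \<zeta> (length a) (length b) (vproj ar \<zeta> \<delta> \<phi>) ?j"
    using vproj_hproj[OF \<phi> j zero_ord_le[OF z]] by (simp only:)
  also have "\<dots> = base_fm ar (length b) {\<chi>. lit_rename ?j \<chi> \<in> Q}"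
    unfolding Q by (rule hproj_base_fm[OF z j])
  finally have \<psi>: "vproj ar \<zeta> \<delta> \<psi> = base_fm ar (length b) {\<chi>. lit_rename ?j \<chi> \<in> Q}" .
  have v: "(Rel R vs :: ('r, 'o, 'k) fml) \<in> atoms ar (length b)"
    using vs by (auto simp: atoms_def)
  have "lit_rename ?j (Rel R vs :: ('r, 'o, 'k) fml) \<in> atoms ar (length a)"
    by (rule lit_rename_atoms[OF v]) (use j vs(1) in \<open>auto simp: injs_def\<close>)
  then show ?thesis
    unfolding Q \<psi> using v by (simp add: atom_in_conjuncts_base_fm comp_def)
qed

text \<open>The arguments may repeat and need not involve all of \<open>a\<close>, while
  \<open>model\<close> consults the list of their distinct entries; \<open>atom_transfer\<close>
  leads from that list to \<open>a\<close>.\<close>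

lemma sat_model_Rel:
  assumes coh: "coherent D P" and a: "(a, \<phi>) \<in> P" and z: "zero_ord \<zeta>"
    and us: "set us \<subseteq> {..<length a}" "length us = ar R"
  shows "sat (model D P) (Rel R us) ((!) a) \<longleftrightarrow> Rel R us \<in> conjuncts (vproj ar \<zeta> \<delta> \<phi>)"
proof -
  let ?as = "map ((!) a) us"
  let ?b = "remdups ?as"
  have d: "distinct a" "set a \<subseteq> D"
    using coherentD(1,2)[OF coh a] .
  have b: "set ?b \<subseteq> set a"
    using us(1) by auto
  have us_eq: "map (pos a) ?as = us"
    using us(1) pos_nth[OF d(1)] by (auto intro!: map_idI)
  have \<zeta>: "\<zeta>' = \<zeta>" if "zero_ord \<zeta>'" for \<zeta>' :: 'o
    using that z zero_ord_le by (metis order_antisym)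
  obtain \<psi> where \<psi>: "(?b, \<psi>) \<in> P"
    using coherentD(4)[OF coh, of ?b] b d(2) by auto
  \<comment> \<open>The positions of the arguments among their distinct entries, a witness for the
    existential quantifier in \<open>model\<close>.\<close>
  let ?vs = "map (pos ?b) ?as"
  have vs: "?as = map ((!) ?b) ?vs" "set ?vs \<subseteq> {..<length ?b}"
    using nth_pos[of ?b] by (auto intro!: map_idI[symmetric])
  have tr: "Rel R vs \<in> conjuncts (vproj ar \<zeta> \<delta> \<psi>') \<longleftrightarrow> Rel R us \<in> conjuncts (vproj ar \<zeta> \<delta> \<phi>)"
    if vs: "set vs \<subseteq> {..<length ?b}" "?as = map ((!) ?b) vs" "(?b, \<psi>') \<in> P" for vs \<psi>'
  proof -
    have "length vs = ar R"
      using arg_cong[OF vs(2), of length] us(2) by simp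
    then have "Rel R vs \<in> conjuncts (vproj ar \<zeta> \<delta> \<psi>') \<longleftrightarrow>
      Rel R (map (pos a) (map ((!) ?b) vs)) \<in> conjuncts (vproj ar \<zeta> \<delta> \<phi>)"
      by (intro atom_transfer[OF coh a vs(3) b z vs(1)])
    then show ?thesis
      by (simp only: vs(2)[symmetric] us_eq)
  qed
  have as: "length ?as = ar R" "set ?as \<subseteq> D"
    using us(2) b d(2) by simp_all
  have "sat (model D P) (Rel R us) ((!) a) \<longleftrightarrow> (\<exists>\<psi>' vs \<zeta>'. zero_ord (\<zeta>' :: 'o) \<and> (?b, \<psi>') \<in> P \<and>
      set vs \<subseteq> {..<length ?b} \<and> ?as = map ((!) ?b) vs \<and> Rel R vs \<in> conjuncts (vproj ar \<zeta>' \<delta> \<psi>'))"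
    using as by (simp only: sat.simps model_def struct.simps mem_Collect_eq simp_thms)
  also have "\<dots> \<longleftrightarrow> Rel R us \<in> conjuncts (vproj ar \<zeta> \<delta> \<phi>)"
  proof
    assume "Rel R us \<in> conjuncts (vproj ar \<zeta> \<delta> \<phi>)"
    then have "Rel R ?vs \<in> conjuncts (vproj ar \<zeta> \<delta> \<psi>)"
      using tr[OF vs(2,1) \<psi>] by (simp only:)
    then show "\<exists>\<psi>' vs \<zeta>'. zero_ord (\<zeta>' :: 'o) \<and> (?b, \<psi>') \<in> P \<and>
      set vs \<subseteq> {..<length ?b} \<and> ?as = map ((!) ?b) vs \<and> Rel R vs \<in> conjuncts (vproj ar \<zeta>' \<delta> \<psi>')"
      by (intro exI[of _ \<psi>] exI[of _ ?vs] exI[of _ \<zeta>] conjI z \<psi> vs)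
  next
    assume "\<exists>\<psi>' vs \<zeta>'. zero_ord (\<zeta>' :: 'o) \<and> (?b, \<psi>') \<in> P \<and>
      set vs \<subseteq> {..<length ?b} \<and> ?as = map ((!) ?b) vs \<and> Rel R vs \<in> conjuncts (vproj ar \<zeta>' \<delta> \<psi>')"
    then show "Rel R us \<in> conjuncts (vproj ar \<zeta> \<delta> \<phi>)"
      using tr \<zeta> by (elim exE conjE) (simp only:)
  qed
  finally show ?thesis .
qed

section \<open>Assigned types are the formulas of the tuples\<close>

lemma tuple_fm_model_zero:
  assumes coh: "coherent D P" and a: "(a, \<phi>) \<in> P" and z: "zero_ord \<alpha>"
  shows "tuple_fm ar (model D P) a \<alpha> = vproj ar \<alpha> \<delta> \<phi>"
proof -
  let ?n = "length a" and ?M = "model D P"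
  have \<phi>: "vproj ar \<alpha> \<delta> \<phi> \<in> Psi ar \<alpha> ?n"
    using vproj_in_Psi[OF zero_ord_le[OF z] level_Psi] coherentD(3)[OF coh a] .
  obtain Q where Q: "vproj ar \<alpha> \<delta> \<phi> = base_fm ar ?n Q" "\<forall>i<?n. \<forall>j<?n. Eq i j \<in> Q \<longleftrightarrow> i = j"
    using Psi_zeroE[OF z \<phi>] .
  have sat: "sat ?M \<chi> ((!) a) \<longleftrightarrow> \<chi> \<in> Q" if \<chi>: "\<chi> \<in> atoms ar ?n" for \<chi> :: "('r, 'o, 'k) fml"
  proof -
    consider R us where "\<chi> = Rel R us" "length us = ar R" "set us \<subseteq> {..<?n}"
      | i j where "\<chi> = Eq i j" "i < ?n" "j < ?n"
      using \<chi> by (auto simp: atoms_def)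
    then show ?thesis
    proof cases
      case 1
      then show ?thesis
        using sat_model_Rel[OF coh a z 1(3,2)] atom_in_conjuncts_base_fm[OF \<chi>] Q(1) by simp
    next
      \<comment> \<open>Both sides say i = j: the entries of \<open>a\<close> are distinct, and
        level-zero formulas decide equations accordingly.\<close>
      case 2
      then show ?thesis
        using Q(2) coherentD(1)[OF coh a] by (simp add: nth_eq_iff_index_eq)
    qed
  qed
  have "{\<chi> \<in> atoms ar ?n \<union> Neg ` atoms ar ?n. sat ?M \<chi> ((!) a)} =
    (\<lambda>\<chi> :: ('r, 'o, 'k) fml. if \<chi> \<in> Q then \<chi> else Neg \<chi>) ` atoms ar ?n"
    using sat by (auto split: if_splits)
  then show ?thesis
    using z by (subst tuple_fm.simps) (simp add: Q(1) base_fm_def)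
qed

lemma vproj_in_level:
  "\<phi> \<in> level ar \<Phi> \<delta> n \<Longrightarrow> \<alpha> \<le> \<delta> \<Longrightarrow> vproj ar \<alpha> \<delta> \<phi> \<in> level ar \<Phi> \<alpha> n"
  using Phi_eq_vproj[of \<alpha>] vproj_in_Psi[of \<alpha> \<delta> \<phi> ar n] unfolding level_def by blast

text \<open>A predicted extension lifts, by \<open>exts_vproj_subset\<close>, to a one-point
  extension of the full type \<phi>, and saturation realizes it. Conversely a realized extension
  restricts to \<phi>, hence so do their projections to level \<alpha>, and \<open>exts_eq\<close>
  at that level lists it.\<close>

lemma exts_vproj_model:
  assumes coh: "coherent D P"
    and sat: "\<And>a \<phi>. \<phi> \<in> level ar \<Phi> \<delta> (Suc (length a)) \<Longrightarrow>
      (a, hproj ar \<delta> (Suc (length a)) (length a) \<phi> id) \<in> P \<Longrightarrow> \<exists>c\<in>D. (a @ [c], \<phi>) \<in> P"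
    and a: "(a, \<phi>) \<in> P" and s: "succ_of \<beta> \<alpha>" and \<alpha>: "\<alpha> \<le> \<delta>"
  shows "exts (vproj ar \<alpha> \<delta> \<phi>) = {vproj ar \<beta> \<delta> \<psi> | \<psi> c. c \<in> D \<and> c \<notin> set a \<and> (a @ [c], \<psi>) \<in> P}"
proof (intro subset_antisym subsetI)
  have \<phi>: "\<phi> \<in> level ar \<Phi> \<delta> (length a)"
    using coherentD(3)[OF coh a] .
  have \<beta>: "\<beta> < \<delta>"
    using succ_less[OF s] \<alpha> by simp
  {
    fix \<chi> assume "\<chi> \<in> exts (vproj ar \<alpha> \<delta> \<phi>)"
    then obtain \<psi> where \<psi>: "\<psi> \<in> level ar \<Phi> \<delta> (Suc (length a))"
        "hproj ar \<delta> (Suc (length a)) (length a) \<psi> id = \<phi>"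
      "\<chi> = vproj ar \<beta> \<delta> \<psi>"
      using exts_vproj_subset[OF s \<beta> \<phi>] by blast
    then obtain c where "c \<in> D" "(a @ [c], \<psi>) \<in> P"
      using sat[of \<psi> a] a by auto
    moreover have "c \<notin> set a"
      using coherentD(1)[OF coh \<open>(a @ [c], \<psi>) \<in> P\<close>] by simp
    ultimately show "\<chi> \<in> {vproj ar \<beta> \<delta> \<psi> | \<psi> c. c \<in> D \<and> c \<notin> set a \<and> (a @ [c], \<psi>) \<in> P}"
      using \<psi>(3) by blast
  next
    fix \<chi> assume "\<chi> \<in> {vproj ar \<beta> \<delta> \<psi> | \<psi> c. c \<in> D \<and> c \<notin> set a \<and> (a @ [c], \<psi>) \<in> P}"
    then obtain \<psi> c where \<psi>: "\<chi> = vproj ar \<beta> \<delta> \<psi>" "(a @ [c], \<psi>) \<in> P"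
      by blast
    have lev: "\<psi> \<in> level ar \<Phi> \<delta> (Suc (length a))"
      using coherentD(3)[OF coh \<psi>(2)] by simp
    have "\<phi> = tp (a @ [c]) \<psi> a"
      using coherent_tp[OF coh \<psi>(2) a] by (simp add: subset_insertI)
    then have "hproj ar \<delta> (Suc (length a)) (length a) \<psi> id = \<phi>"
      using tp_prefix[OF coherentD(1)[OF coh \<psi>(2)]] by simp
    then have "hproj ar \<alpha> (Suc (length a)) (length a) (vproj ar \<alpha> \<delta> \<psi>) id = vproj ar \<alpha> \<delta> \<phi>"
      using vproj_hproj[OF level_Psi[OF lev] injs_id \<alpha>, of "length a"] by simp
    moreover have "vproj ar \<alpha> \<delta> \<psi> \<in> level ar \<Phi> \<alpha> (Suc (length a))"
      using vproj_in_level[OF lev \<alpha>] .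
    moreover have "\<chi> = vproj ar \<beta> \<alpha> (vproj ar \<alpha> \<delta> \<psi>)"
      using vproj_vproj[OF less_imp_le[OF succ_less[OF s]] \<alpha> level_Psi[OF lev]] \<psi>(1) by simp
    ultimately show "\<chi> \<in> exts (vproj ar \<alpha> \<delta> \<phi>)"
      unfolding exts_eq[OF s \<alpha> vproj_in_level[OF \<phi> \<alpha>]] by blast
  }
qed

text \<open>All tuples are treated at once, because the successor case passes from \<open>a\<close>
  to \<open>a @ [c]\<close>.\<close>

lemma tuple_fm_model:
  assumes coh: "coherent D P"
    and sat: "\<And>a \<phi>. \<phi> \<in> level ar \<Phi> \<delta> (Suc (length a)) \<Longrightarrow>
      (a, hproj ar \<delta> (Suc (length a)) (length a) \<phi> id) \<in> P \<Longrightarrow> \<exists>c\<in>D. (a @ [c], \<phi>) \<in> P"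
    and "(a, \<phi>) \<in> P" "\<alpha> \<le> \<delta>"
  shows "tuple_fm ar (model D P) a \<alpha> = vproj ar \<alpha> \<delta> \<phi>"
  using assms(3,4)
proof (induction \<alpha> arbitrary: a \<phi> rule: ord_induct)
  case (zero \<alpha>)
  then show ?case
    using tuple_fm_model_zero[OF coh] by blast
next
  case (succ \<beta> \<alpha>)
  note a = succ.prems(1) and \<alpha> = succ.prems(2)
  have \<beta>: "\<beta> \<le> \<delta>"
    using succ_less[OF succ.hyps] \<alpha> by simp
  have \<phi>: "\<phi> \<in> Psi ar \<delta> (length a)"
    using level_Psi[OF coherentD(3)[OF coh a]] .
  have "(\<lambda>c. tuple_fm ar (model D P) (a @ [c]) \<beta>) ` (D - set a) = exts (vproj ar \<alpha> \<delta> \<phi>)"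
    (is "?l = _")
  proof -
    have "?l = {vproj ar \<beta> \<delta> \<psi> | \<psi> c. c \<in> D \<and> c \<notin> set a \<and> (a @ [c], \<psi>) \<in> P}" (is "_ = ?r")
    proof (intro subset_antisym subsetI)
      fix \<chi> assume "\<chi> \<in> ?l"
      then obtain c where c: "c \<in> D" "c \<notin> set a" "\<chi> = tuple_fm ar (model D P) (a @ [c]) \<beta>"
        by blast
      then obtain \<psi> where "(a @ [c], \<psi>) \<in> P"
        using coherentD(4)[OF coh, of "a @ [c]"] coherentD(1,2)[OF coh a] by auto
      then show "\<chi> \<in> ?r"
        using c succ.IH[OF _ \<beta>] by blast
    next
      fix \<chi> assume "\<chi> \<in> ?r"
      then obtain c \<psi> where c: "c \<in> D - set a" "(a @ [c], \<psi>) \<in> P" "\<chi> = vproj ar \<beta> \<delta> \<psi>"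
        by blast
      have "\<chi> = tuple_fm ar (model D P) (a @ [c]) \<beta>"
        unfolding c(3) by (rule succ.IH[OF c(2) \<beta>, symmetric])
      then show "\<chi> \<in> ?l"
        using c(1) by (rule image_eqI)
    qed
    then show ?thesis
      by (simp only: exts_vproj_model[OF coh sat a succ.hyps \<alpha>])
  qed
  moreover have "tuple_fm ar (model D P) a \<beta> = first (vproj ar \<alpha> \<delta> \<phi>)"
    using succ.IH[OF a \<beta>] vproj_vproj[OF less_imp_le[OF succ_less[OF succ.hyps]] \<alpha> \<phi>]
      vproj_succ[OF succ.hyps order_refl, of ar "vproj ar \<alpha> \<delta> \<phi>"] by simp
  ultimately show ?case
    using Psi_succE(4)[OF succ.hyps vproj_in_Psi[OF \<alpha> \<phi>]]
    by (simp add: tuple_fm_succ[OF succ.hyps] model_def)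
next
  case (limit \<alpha>)
  have \<phi>: "\<phi> \<in> Psi ar \<delta> (length a)"
    using level_Psi[OF coherentD(3)[OF coh limit.prems(1)]] .
  have "tuple_fm ar (model D P) a \<beta> = vproj ar \<beta> \<alpha> (vproj ar \<alpha> \<delta> \<phi>)" if "\<beta> < \<alpha>" for \<beta>
    using limit.IH[OF that limit.prems(1)]
        vproj_vproj[OF less_imp_le[OF that] limit.prems(2) \<phi>] that limit.prems(2)
    by simp
  then have "(\<lambda>\<beta>. tuple_fm ar (model D P) a \<beta>) ` {..<\<alpha>} = (\<lambda>\<beta>. vproj ar \<beta> \<alpha> (vproj ar \<alpha> \<delta> \<phi>)) ` {..<\<alpha>}"
    by (intro image_cong) auto
  then show ?case
    using Psi_limit_eq[OF limit.hyps vproj_in_Psi[OF limit.prems(2) \<phi>]]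
    by (simp only: tuple_fm_limit[OF limit.hyps])
qed

theorem ex_model: "\<exists>M :: ('r, nat set) struct. is_struct ar M \<and> (\<forall>\<alpha>\<le>\<delta>. struct_level ar M \<alpha> = \<Phi> \<alpha>)"
proof -
  obtain D :: "nat set set" and P where coh: "coherent D P"
    and sat: "\<And>a \<phi>. \<phi> \<in> level ar \<Phi> \<delta> (Suc (length a)) \<Longrightarrow>
      (a, hproj ar \<delta> (Suc (length a)) (length a) \<phi> id) \<in> P \<Longrightarrow> \<exists>c\<in>D. (a @ [c], \<phi>) \<in> P"
    using ex_saturated by blast
  let ?M = "model D P"
  \<comment> \<open>Starting from the unique type of the empty tuple, saturation adds one entry at a
    time: realize the restriction, then extend.\<close>
  have real: "\<exists>a. length a = n \<and> (a, \<phi>) \<in> P" if "\<phi> \<in> level ar \<Phi> \<delta> n" for n \<phi>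
    using that
  proof (induction n arbitrary: \<phi>)
    case 0
    obtain \<psi> where "([], \<psi>) \<in> P"
      using coherentD(4)[OF coh, of "[]"] by auto
    moreover have "\<psi> = \<phi>"
      using coherentD(3)[OF coh calculation] 0 level_0_singleton by auto
    ultimately show ?case
      by auto
  next
    case (Suc n)
    then obtain a where "length a = n" "(a, hproj ar \<delta> (Suc n) n \<phi> id) \<in> P"
      using hproj_in_level[OF Suc.prems injs_id[of n "Suc n"]] by auto
    then obtain c where "(a @ [c], \<phi>) \<in> P"
      using sat[of \<phi> a] Suc.prems by auto
    then show ?case
      using \<open>length a = n\<close> by (intro exI[of _ "a @ [c]"]) simp
  qed
  \<comment> \<open>A structure must have an element. The nonempty level for no variables is the
    image of the one for a single variable, whose types are realized.\<close>
  have "level ar \<Phi> \<delta> (Suc 0) \<noteq> {}"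
    using level_0_singleton level_hproj[of 0 "Suc 0"] by auto
  then obtain a \<phi> where "length a = Suc 0" "(a, \<phi>) \<in> P"
    using real by blast
  then have "D \<noteq> {}"
    using coherentD(2)[OF coh, of a \<phi>] by (cases a) auto
  then have "is_struct ar ?M"
    by (auto simp: is_struct_def model_def)
  moreover have "struct_level ar ?M \<alpha> = \<Phi> \<alpha>" if \<alpha>: "\<alpha> \<le> \<delta>" for \<alpha>
  proof (intro subset_antisym subsetI)
    fix \<chi> :: "('r, 'o, 'k) fml" assume "\<chi> \<in> struct_level ar ?M \<alpha>"
    then obtain a where a: "distinct a" "set a \<subseteq> D" "\<chi> = tuple_fm ar ?M a \<alpha>"
      by (auto simp: struct_level_def model_def)
    then obtain \<phi> where \<phi>: "(a, \<phi>) \<in> P"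
      using coherentD(4)[OF coh] by blast
    then have "\<chi> = vproj ar \<alpha> \<delta> \<phi>"
      using tuple_fm_model[OF coh sat \<phi> \<alpha>] a(3) by simp
    then show "\<chi> \<in> \<Phi> \<alpha>"
      using coherentD(3)[OF coh \<phi>] Phi_eq_vproj[OF \<alpha>] by (auto simp: level_def)
  next
    fix \<chi> assume "\<chi> \<in> \<Phi> \<alpha>"
    then obtain \<phi> where \<phi>: "\<phi> \<in> \<Phi> \<delta>" "\<chi> = vproj ar \<alpha> \<delta> \<phi>"
      using Phi_eq_vproj[OF \<alpha>] by blast
    then obtain n where "\<phi> \<in> level ar \<Phi> \<delta> n"
      using Phi_subset by (auto simp: level_def)
    then obtain a where a: "(a, \<phi>) \<in> P"
      using real by blast
    have "\<chi> = tuple_fm ar ?M a \<alpha>"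
      using tuple_fm_model[OF coh sat a \<alpha>] \<phi>(2) by simp
    then show "\<chi> \<in> struct_level ar ?M \<alpha>"
      using coherentD(1,2)[OF coh a] by (auto simp: struct_level_def model_def)
  qed
  ultimately show ?thesis
    by blast
qed

end

theorem theorem7p10:
  fixes ar :: "'r \<Rightarrow> nat"
    and \<delta> :: "'o::wellorder"
    and \<Phi> :: "'o \<Rightarrow> ('r, 'o, 'k) fml set"
  assumes zero_ary: "\<exists>R. ar R = 0"
    and process: "scott_process ar {..\<delta>} \<Phi>"
    and nonempty: "\<forall>\<alpha>\<le>\<delta>. \<Phi> \<alpha> \<noteq> {}"
    and amalg: "amalgamates ar \<delta> (\<Phi> \<delta>)"
    and card: "|\<Phi> \<delta>| \<le>o cardSuc natLeq"  \<comment> \<open>\<open>cardSuc natLeq\<close> is $\aleph_1$\<close>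
  shows "\<exists>M :: ('r, nat set) struct. is_struct ar M \<and> (\<forall>\<alpha>\<le>\<delta>. struct_level ar M \<alpha> = \<Phi> \<alpha>)"
proof -
  interpret amalgamating_process ar \<delta> \<Phi>
    by (rule amalgamating_process.intro) (use process nonempty amalg card in auto)
  show ?thesis
    by (rule ex_model)
qed

end
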